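(* Let $\mathcal F=(\mathcal V,*,\mu_{ell})$ be an extended Farey symbol with group $\Gamma\subset\mathrm{PSL}_2(\mathbb Z)$ and gluing data $(\gamma_a)_{a\in\mathcal V}$. Let $E=(\mathcal V-\mathcal V_{ell})/*$ be a set of representatives of the quotient of $\mathcal V-\mathcal V_{ell}$ by the involution $*$, whose first element is assumed to be the path $(\infty,0)$, and let $\mathcal A=E\sqcup\mathcal V_{ell}$. Then the $\mathbb Z[\Gamma]$-module $\Delta_0=\mathbb Z[\mathbb P^1(\mathbb Q)]_0$ is the quotient of the free $\mathbb Z[\Gamma]$-module generated by the elements of $\mathcal A$ by the relations $$\sum_{a\in\mathcal A}\lambda_a a=0,\qquad \mu_a a=0\ \text{ for } a\in\mathcal V_{ell},$$ with (1) $\lambda_a=1-\gamma_a^{-1}$ for $a\in E$ and $\lambda_a=1$ for $a\in\mathcal V_{ell}$; (2) $\mu_a=\sum_{s=0}^{\mu-1}\gamma_a^s$ for $a\in\mathcal V_{ell}$ with $\mu_{ell}(a)=\mu$.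
   Context: Notation. $\mathcal H$ is the Poincaré upper half-plane and $\mathcal H^*=\mathcal H\sqcup\mathbb P^1(\mathbb Q)$. For distinct $r,s\in\mathbb P^1(\mathbb Q)$, $a=(r,s)$ is the oriented geodesic arc (path) in $\mathcal H^*$ from $r$ to $s$, $\overline a=(s,r)$ is the opposite arc, and $A_a=\begin{pmatrix} x_a & y_a \\ z_a & t_a \end{pmatrix}\in M_2(\mathbb Z)$ is the matrix, unique up to sign, with $\det A_a>0$, $r=x_a/z_a$, $s=y_a/t_a$, $\gcd(x_a,z_a)=\gcd(y_a,t_a)=1$. Put $A_a^-=A_a\begin{pmatrix} 0 & -1 \\ 1 & 0 \end{pmatrix}$, which represents $\overline a$. Extended Farey symbol: a triple $(\mathcal V,*,\mu_{ell})$ consisting of: (F1) an oriented convex hyperbolic polygon whose vertices $r_1,\dots,r_n$ are in $\mathbb P^1(\mathbb Q)$; its boundary is the sequence $\mathcal V$ of consecutive arcs $a_1=(r_1,r_2),\ a_2=(r_2,r_3),\dots,a_n=(r_n,r_1)$, considered up to cyclic permutation, and one of the $a_i$ is assumed to be the arc $(\infty,0)$; (F2) an involution $a\mapsto a^*$ of $\mathcal V$; (F3) a map $\mu_{ell}:\mathcal V_{ell}\to\{2,3\}$, where $\mathcal V_{ell}$ is the set of fixed points of $*$; such that (F4) each of the following gluing matrices $\gamma_a$, $a\in\mathcal V$ (the gluing data), lies in $\mathrm{SL}_2(\mathbb Z)$: $\gamma_a=A_a(A_{a^*}^-)^{-1}$ if $a\notin\mathcal V_{ell}$; $\gamma_a=A_a(A_a^-)^{-1}$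 if $a\in\mathcal V_{ell}$ and $\mu_{ell}(a)=2$; $\gamma_a=A_a^-\begin{pmatrix} 0 & -1 \\ 1 & -1 \end{pmatrix}(A_a^-)^{-1}$ if $a\in\mathcal V_{ell}$ and $\mu_{ell}(a)=3$. The group of the symbol is the subgroup $\Gamma\subset\mathrm{PSL}_2(\mathbb Z)$ generated by the $\gamma_a$, $a\in\mathcal V$. In $\mathbb Z[\Gamma]$, $\gamma_a$ denotes its image in $\Gamma$. $\mathbb Z[\mathbb P^1(\mathbb Q)]$ is the group of divisors on $\mathbb P^1(\mathbb Q)$, with basis elements written $\{c\}$, on which $\Gamma$ acts via its action on $\mathbb P^1(\mathbb Q)$; $\Delta_0$ is the subgroup of divisors of degree $0$. An arc $a=(r,s)$ is identified with the divisor $\{s\}-\{r\}\in\Delta_0$; this gives the map from the free module to $\Delta_0$. *)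

theory Defs
  imports "HOL-Analysis.Analysis" "HOL-Algebra.Algebra"
begin

section \<open>The projective line over the rationals and oriented arcs\<close>

datatype cusp = Infty | Fin rat

type_synonym arc = "cusp \<times> cusp"

type_synonym mat2 = "rat ^ 2 ^ 2"

definition mat22 :: "rat \<Rightarrow> rat \<Rightarrow> rat \<Rightarrow> rat \<Rightarrow> mat2" where
  "mat22 x y z t = vector [vector [x, y], vector [z, t]]"

fun moebius :: "mat2 \<Rightarrow> cusp \<Rightarrow> cusp" where
  "moebius A Infty = (if A$2$1 = 0 then Infty else Fin (A$1$1 / A$2$1))"
| "moebius A (Fin q) =
     (if A$2$1 * q + A$2$2 = 0 then Infty
      else Fin ((A$1$1 * q + A$1$2) / (A$2$1 * q + A$2$2)))"

fun cusp_coords :: "cusp \<Rightarrow> int \<times> int" where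
  "cusp_coords Infty = (1, 0)"
| "cusp_coords (Fin q) = quotient_of q"

text \<open>The matrix of an arc is only defined up to sign; \<open>arc_matrix\<close> fixes one of the two choices
  (\<open>represents_arc_arc_matrix\<close>, \<open>represents_arc_unique\<close>).\<close>

definition arc_matrix :: "arc \<Rightarrow> mat2" where
  "arc_matrix a =
     (let (x, z) = cusp_coords (fst a); (y, t) = cusp_coords (snd a) in
      if x * t - y * z > 0 then mat22 (of_int x) (of_int y) (of_int z) (of_int t)
      else mat22 (of_int x) (of_int (- y)) (of_int z) (of_int (- t)))"

definition arc_matrix_neg :: "arc \<Rightarrow> mat2" where
  "arc_matrix_neg a = arc_matrix a ** mat22 0 (- 1) 1 0"

definition represents_arc :: "mat2 \<Rightarrow> arc \<Rightarrow> bool" where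
  "represents_arc A a \<longleftrightarrow>
     (\<exists>x y z t :: int. A = mat22 (of_int x) (of_int y) (of_int z) (of_int t) \<and>
        coprime x z \<and> coprime y t) \<and>
     det A > 0 \<and> moebius A Infty = fst a \<and> moebius A (Fin 0) = snd a"

lemma mat22_nth [simp]:
  "mat22 x y z t $ 1 $ 1 = x" "mat22 x y z t $ 1 $ 2 = y"
  "mat22 x y z t $ 2 $ 1 = z" "mat22 x y z t $ 2 $ 2 = t"
  by (simp_all add: mat22_def)

lemma det_mat22: "det (mat22 x y z t) = x * t - y * z"
  by (simp add: det_2)

lemma cusp_coords_coprime: "cusp_coords c = (x, z) \<Longrightarrow> coprime x z"
  by (cases c) (auto dest: quotient_of_coprime)

lemma cusp_coords_value:
  "cusp_coords c = (x, z) \<Longrightarrow> c = (if z = 0 then Infty else Fin (of_int x / of_int z))"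
  using quotient_of_div quotient_of_denom_pos by (cases c) fastforce+

lemma coprime_eq_up_to_sign:
  fixes x y z t :: int
  assumes "coprime x z" "coprime y t" "x * t = y * z"
  shows "(x = y \<and> z = t) \<or> (x = - y \<and> z = - t)"
proof -
  have "x dvd y" "y dvd x" "z dvd t" "t dvd z"
    using assms by (metis coprime_commute coprime_dvd_mult_left_iff coprime_dvd_mult_right_iff dvd_triv_left dvd_triv_right mult.commute)+
  then have "\<bar>x\<bar> = \<bar>y\<bar>" "\<bar>z\<bar> = \<bar>t\<bar>" by (blast intro: zdvd_antisym_abs)+
  then have xy: "x = y \<or> x = - y" and zt: "z = t \<or> z = - t" by linarith+
  have "y * t = 0" if "x = y \<and> z = - t \<or> x = - y \<and> z = t"
    using that assms(3) by auto
  then show ?thesis using xy zt by auto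
qed

lemma represents_arc_arc_matrix:
  assumes "fst a \<noteq> snd a"
  shows "represents_arc (arc_matrix a) a"
proof -
  obtain x z where xz: "cusp_coords (fst a) = (x, z)" by (cases "cusp_coords (fst a)")
  obtain y t where yt: "cusp_coords (snd a) = (y, t)" by (cases "cusp_coords (snd a)")
  note cop = cusp_coords_coprime[OF xz] cusp_coords_coprime[OF yt]
  note val = cusp_coords_value[OF xz] cusp_coords_value[OF yt]
  have "x * t - y * z \<noteq> 0"
    using coprime_eq_up_to_sign[OF cop] assms val by (cases "t = 0") auto
  define e :: int where "e = (if x * t - y * z > 0 then 1 else -1)"
  have A: "arc_matrix a = mat22 (of_int x) (of_int (e * y)) (of_int z) (of_int (e * t))"
    by (simp add: arc_matrix_def xz yt e_def)
  have "coprime (e * y) (e * t)" using cop by (simp add: e_def)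
  moreover have "of_int (x * (e * t) - e * y * z) > (0::rat)"
    using \<open>x * t - y * z \<noteq> 0\<close> unfolding of_int_0_less_iff by (simp add: e_def)
  ultimately show ?thesis
    unfolding represents_arc_def A det_mat22
    using cop val by (intro conjI) (blast, auto simp: e_def)
qed

lemma represents_arc_unique:
  assumes "represents_arc A a" "represents_arc B a"
  shows "B = A \<or> B = - A"
proof -
  obtain x y z t :: int where A: "A = mat22 (of_int x) (of_int y) (of_int z) (of_int t)"
    "coprime x z" "coprime y t" using assms(1) unfolding represents_arc_def by blast
  obtain x' y' z' t' :: int where B: "B = mat22 (of_int x') (of_int y') (of_int z') (of_int t')"
    "coprime x' z'" "coprime y' t'" using assms(2) unfolding represents_arc_def by blast
  have D: "of_int (x * t - y * z) > (0::rat)" "of_int (x' * t' - y' * z') > (0::rat)"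
    using assms unfolding represents_arc_def by (simp_all add: A B det_mat22)
  then have d: "x * t - y * z > 0" "x' * t' - y' * z' > 0" by (simp_all only: of_int_0_less_iff)
  have e: "moebius A Infty = moebius B Infty" "moebius A (Fin 0) = moebius B (Fin 0)"
    using assms unfolding represents_arc_def by simp_all
  have "of_int (x * z') = (of_int (x' * z) :: rat)" "of_int (y * t') = (of_int (y' * t) :: rat)"
    using e by (auto simp: A B divide_simps split: if_splits)
  then have "x * z' = x' * z" "y * t' = y' * t" by (simp_all only: of_int_eq_iff)
  then have "(x = x' \<and> z = z') \<or> (x = - x' \<and> z = - z')" "(y = y' \<and> t = t') \<or> (y = - y' \<and> t = - t')"
    using A B coprime_eq_up_to_sign by metis+
  then show ?thesis using d by (auto simp: A B vec_eq_iff forall_2)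
qed


section \<open>Convex polygons with cuspidal vertices\<close>

text \<open>The cusps on the left of the oriented geodesic \<open>(\<infinity>, 0)\<close> are the positive rationals, and
  \<open>arc_matrix a\<close> acts on the upper half-plane preserving orientation and maps \<open>(\<infinity>, 0)\<close> to \<open>a\<close>.\<close>

definition left_cusps :: "arc \<Rightarrow> cusp set" where
  "left_cusps a = moebius (arc_matrix a) ` Fin ` {0<..}"

definition polygon_sides :: "cusp list \<Rightarrow> arc set" where
  "polygon_sides rs = set (zip rs (rotate1 rs))"

text \<open>The list of vertices of a convex hyperbolic polygon with its direct (counterclockwise)
  orientation: the polygon lies on the left of each of its sides.\<close>

definition convex_ideal_polygon :: "cusp list \<Rightarrow> bool" where
  "convex_ideal_polygon rs \<longleftrightarrow>
     length rs \<ge> 3 \<and> distinct rs \<and>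
     (\<forall>(r, s) \<in> polygon_sides rs. set rs - {r, s} \<subseteq> left_cusps (r, s))"


section \<open>The group of orientation preserving integral transformations\<close>

definition SL2Z :: "mat2 monoid" where
  "SL2Z = \<lparr>carrier = {A. (\<forall>i j. A$i$j \<in> \<int>) \<and> det A = 1}, monoid.mult = (**), one = mat 1\<rparr>"

definition PSL2Z :: "mat2 set monoid" where
  "PSL2Z = SL2Z Mod {mat 1, - mat 1}"

definition psl_class :: "mat2 \<Rightarrow> mat2 set" where
  "psl_class A = {mat 1, - mat 1} #>\<^bsub>SL2Z\<^esub> A"

definition psl_act :: "mat2 set \<Rightarrow> cusp \<Rightarrow> cusp" where
  "psl_act g c = the_elem ((\<lambda>A. moebius A c) ` g)"


section \<open>Extended Farey symbols\<close>

definition elliptic_arcs :: "arc set \<Rightarrow> (arc \<Rightarrow> arc) \<Rightarrow> arc set" where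
  "elliptic_arcs V star = {a \<in> V. star a = a}"

definition gluing :: "(arc \<Rightarrow> arc) \<Rightarrow> (arc \<Rightarrow> nat) \<Rightarrow> arc \<Rightarrow> mat2" where
  "gluing star mu a =
     (if star a \<noteq> a then arc_matrix a ** matrix_inv (arc_matrix_neg (star a))
      else if mu a = 2 then arc_matrix a ** matrix_inv (arc_matrix_neg a)
      else arc_matrix_neg a ** mat22 0 (- 1) 1 (- 1) ** matrix_inv (arc_matrix_neg a))"

text \<open>The vertices of the polygon are distinct, so that its boundary, taken up to cyclic permutation,
  is determined by the set of its sides. Only the values of \<open>star\<close> on \<open>V\<close> and of \<open>mu\<close> on
  \<open>elliptic_arcs V star\<close> are relevant.\<close>

locale extended_farey_symbol =
  fixes V :: "arc set" and star :: "arc \<Rightarrow> arc" and mu :: "arc \<Rightarrow> nat"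
  assumes polygon: "\<exists>rs. convex_ideal_polygon rs \<and> V = polygon_sides rs"
    and base_arc: "(Infty, Fin 0) \<in> V"
    and star_closed: "a \<in> V \<Longrightarrow> star a \<in> V"
    and star_star: "a \<in> V \<Longrightarrow> star (star a) = a"
    and mu_range: "a \<in> elliptic_arcs V star \<Longrightarrow> mu a \<in> {2, 3}"
    and gluing_integral: "a \<in> V \<Longrightarrow> gluing star mu a \<in> carrier SL2Z"

definition gluing_class :: "(arc \<Rightarrow> arc) \<Rightarrow> (arc \<Rightarrow> nat) \<Rightarrow> arc \<Rightarrow> mat2 set" where
  "gluing_class star mu a = psl_class (gluing star mu a)"

definition farey_group :: "arc set \<Rightarrow> (arc \<Rightarrow> arc) \<Rightarrow> (arc \<Rightarrow> nat) \<Rightarrow> mat2 set monoid" where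
  "farey_group V star mu =
     PSL2Z\<lparr>carrier := generate PSL2Z (gluing_class star mu ` V)\<rparr>"

definition representatives :: "arc set \<Rightarrow> (arc \<Rightarrow> arc) \<Rightarrow> arc set \<Rightarrow> bool" where
  "representatives V star E \<longleftrightarrow>
     E \<subseteq> V - elliptic_arcs V star \<and>
     (\<forall>a \<in> V - elliptic_arcs V star. \<exists>!e. e \<in> E \<and> (e = a \<or> e = star a))"


section \<open>Group rings and left modules\<close>

definition group_ring :: "('g, 'm) monoid_scheme \<Rightarrow> ('g \<Rightarrow>\<^sub>0 int) ring" where
  "group_ring G =
     \<lparr>carrier = {x. Poly_Mapping.keys x \<subseteq> carrier G},
      monoid.mult = (\<lambda>x y. frag_extend (\<lambda>g. frag_extend (\<lambda>h. frag_of (g \<otimes>\<^bsub>G\<^esub> h)) y) x),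
      one = frag_of \<one>\<^bsub>G\<^esub>,
      ring.zero = 0,
      ring.add = (+)\<rparr>"

text \<open>The library's locale \<open>module\<close> is restricted to commutative rings. Its record type is reused
  here; the multiplicative part of the record is irrelevant.\<close>

locale left_module = R?: ring R + M?: abelian_group M
  for R :: "('r, 'k) ring_scheme" (structure) and M :: "('r, 'a, 'm) module_scheme" (structure) +
  assumes smult_closed:
      "\<lbrakk>a \<in> carrier R; x \<in> carrier M\<rbrakk> \<Longrightarrow> a \<odot>\<^bsub>M\<^esub> x \<in> carrier M"
    and smult_l_distr:
      "\<lbrakk>a \<in> carrier R; b \<in> carrier R; x \<in> carrier M\<rbrakk> \<Longrightarrow>
      (a \<oplus> b) \<odot>\<^bsub>M\<^esub> x = a \<odot>\<^bsub>M\<^esub> x \<oplus>\<^bsub>M\<^esub> b \<odot>\<^bsub>M\<^esub> x"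
    and smult_r_distr:
      "\<lbrakk>a \<in> carrier R; x \<in> carrier M; y \<in> carrier M\<rbrakk> \<Longrightarrow>
      a \<odot>\<^bsub>M\<^esub> (x \<oplus>\<^bsub>M\<^esub> y) = a \<odot>\<^bsub>M\<^esub> x \<oplus>\<^bsub>M\<^esub> a \<odot>\<^bsub>M\<^esub> y"
    and smult_assoc:
      "\<lbrakk>a \<in> carrier R; b \<in> carrier R; x \<in> carrier M\<rbrakk> \<Longrightarrow>
      (a \<otimes> b) \<odot>\<^bsub>M\<^esub> x = a \<odot>\<^bsub>M\<^esub> (b \<odot>\<^bsub>M\<^esub> x)"
    and smult_one: "x \<in> carrier M \<Longrightarrow> \<one> \<odot>\<^bsub>M\<^esub> x = x"

definition left_module_iso ::
  "('r, 'k) ring_scheme \<Rightarrow> ('r, 'a, 'm) module_scheme \<Rightarrow> ('r, 'b, 'n) module_scheme \<Rightarrow> ('a \<Rightarrow> 'b) set"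
  where
  "left_module_iso R M N =
     {h. bij_betw h (carrier M) (carrier N) \<and>
         (\<forall>x \<in> carrier M. \<forall>y \<in> carrier M. h (x \<oplus>\<^bsub>M\<^esub> y) = h x \<oplus>\<^bsub>N\<^esub> h y) \<and>
         (\<forall>r \<in> carrier R. \<forall>x \<in> carrier M. h (r \<odot>\<^bsub>M\<^esub> x) = r \<odot>\<^bsub>N\<^esub> h x)}"

definition free_module :: "('r, 'k) ring_scheme \<Rightarrow> 's set \<Rightarrow> ('r, 's \<Rightarrow> 'r) module" where
  "free_module R S =
     \<lparr>carrier = {f \<in> S \<rightarrow>\<^sub>E carrier R. finite {s \<in> S. f s \<noteq> \<zero>\<^bsub>R\<^esub>}},
      monoid.mult = undefined,
      one = undefined,
      ring.zero = (\<lambda>s\<in>S. \<zero>\<^bsub>R\<^esub>),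
      ring.add = (\<lambda>f g. \<lambda>s\<in>S. f s \<oplus>\<^bsub>R\<^esub> g s),
      smult = (\<lambda>r f. \<lambda>s\<in>S. r \<otimes>\<^bsub>R\<^esub> f s)\<rparr>"

definition free_gen :: "('r, 'k) ring_scheme \<Rightarrow> 's set \<Rightarrow> 's \<Rightarrow> ('s \<Rightarrow> 'r)" where
  "free_gen R S a = (\<lambda>s\<in>S. if s = a then \<one>\<^bsub>R\<^esub> else \<zero>\<^bsub>R\<^esub>)"

definition generated_submodule ::
  "('r, 'k) ring_scheme \<Rightarrow> ('r, 'a, 'm) module_scheme \<Rightarrow> 'a set \<Rightarrow> 'a set" where
  "generated_submodule R M S = \<Inter>{N. submodule N R M \<and> S \<subseteq> N}"

definition quotient_module ::
  "('r, 'a, 'm) module_scheme \<Rightarrow> 'a set \<Rightarrow> ('r, 'a set) module" where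
  "quotient_module M N =
     \<lparr>carrier = a_rcosets\<^bsub>M\<^esub> N,
      monoid.mult = undefined,
      one = undefined,
      ring.zero = N,
      ring.add = set_add M,
      smult = (\<lambda>r C. \<Union>x\<in>C. N +>\<^bsub>M\<^esub> (r \<odot>\<^bsub>M\<^esub> x))\<rparr>"


section \<open>Divisors of degree zero and the Farey relations\<close>

definition divisor_degree :: "(cusp \<Rightarrow>\<^sub>0 int) \<Rightarrow> int" where
  "divisor_degree D = (\<Sum>c \<in> Poly_Mapping.keys D. Poly_Mapping.lookup D c)"

definition Delta0 :: "(mat2 set \<Rightarrow>\<^sub>0 int, cusp \<Rightarrow>\<^sub>0 int) module" where
  "Delta0 =
     \<lparr>carrier = {D. divisor_degree D = 0},
      monoid.mult = undefined,
      one = undefined,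
      ring.zero = 0,
      ring.add = (+),
      smult = (\<lambda>x D. frag_extend (\<lambda>g. frag_extend (\<lambda>c. frag_of (psl_act g c)) D) x)\<rparr>"

definition arc_divisor :: "arc \<Rightarrow> (cusp \<Rightarrow>\<^sub>0 int)" where
  "arc_divisor a = frag_of (snd a) - frag_of (fst a)"

definition farey_lambda ::
  "arc set \<Rightarrow> (arc \<Rightarrow> arc) \<Rightarrow> (arc \<Rightarrow> nat) \<Rightarrow> arc \<Rightarrow> (mat2 set \<Rightarrow>\<^sub>0 int)" where
  "farey_lambda V star mu a =
     (let \<Gamma> = farey_group V star mu in
      if a \<in> elliptic_arcs V star then frag_of \<one>\<^bsub>\<Gamma>\<^esub>
      else frag_of \<one>\<^bsub>\<Gamma>\<^esub> - frag_of (inv\<^bsub>\<Gamma>\<^esub> (gluing_class star mu a)))"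

definition farey_mu ::
  "arc set \<Rightarrow> (arc \<Rightarrow> arc) \<Rightarrow> (arc \<Rightarrow> nat) \<Rightarrow> arc \<Rightarrow> (mat2 set \<Rightarrow>\<^sub>0 int)" where
  "farey_mu V star mu a =
     (let \<Gamma> = farey_group V star mu in
      \<Sum>s<mu a. frag_of (gluing_class star mu a [^]\<^bsub>\<Gamma>\<^esub> s))"

definition farey_relations ::
  "arc set \<Rightarrow> (arc \<Rightarrow> arc) \<Rightarrow> (arc \<Rightarrow> nat) \<Rightarrow> arc set \<Rightarrow> (arc \<Rightarrow> (mat2 set \<Rightarrow>\<^sub>0 int)) set" where
  "farey_relations V star mu \<A> =
     (let R = group_ring (farey_group V star mu); F = free_module R \<A> in
      insert (\<Oplus>\<^bsub>F\<^esub> a \<in> \<A>. farey_lambda V star mu a \<odot>\<^bsub>F\<^esub> free_gen R \<A> a)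
        ((\<lambda>a. farey_mu V star mu a \<odot>\<^bsub>F\<^esub> free_gen R \<A> a) ` elliptic_arcs V star))"


section \<open>The module structures are well defined\<close>

lemma frag_bilinear_assoc:
  assumes "Poly_Mapping.keys x \<subseteq> S" "Poly_Mapping.keys y \<subseteq> S"
    and "\<And>g h c. \<lbrakk>g \<in> S; h \<in> S; c \<in> Poly_Mapping.keys z\<rbrakk> \<Longrightarrow> act (mul g h) c = act g (act h c)"
  shows "frag_extend (\<lambda>g. frag_extend (\<lambda>c. frag_of (act g c)) z)
           (frag_extend (\<lambda>g. frag_extend (\<lambda>h. frag_of (mul g h)) y) x) =
         frag_extend (\<lambda>g. frag_extend (\<lambda>c. frag_of (act g c))
           (frag_extend (\<lambda>h. frag_extend (\<lambda>c. frag_of (act h c)) z) y)) x"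
  using assms(1)
proof (induction x rule: frag_induction)
  case (one g)
  show ?case using assms(2)
  proof (induction y rule: frag_induction)
    case (one h)
    have "frag_extend (\<lambda>c. frag_of (act (mul g h) c)) z = frag_extend (\<lambda>c. frag_of (act g (act h c))) z"
      by (rule frag_extend_eq) (use assms(3) one \<open>g \<in> S\<close> in auto)
    then show ?case
      using frag_extend_compose[of "\<lambda>c. frag_of (act g c)" "act h" z] by (simp add: o_def)
  qed (simp_all add: frag_extend_diff)
qed (simp_all add: frag_extend_diff)

lemma frag_extend_fun_add: "frag_extend (\<lambda>i. f i + g i) x = frag_extend f x + frag_extend g x"
  by (simp add: frag_extend_def frag_cmul_distrib2 sum.distrib)

lemma ring_group_ring:
  assumes "group G"
  shows "ring (group_ring G)"
proof -
  interpret group G by fact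
  show ?thesis
  proof (intro ringI abelian_groupI monoidI)
    fix x y assume "x \<in> carrier (group_ring G)" "y \<in> carrier (group_ring G)"
    then show "x \<otimes>\<^bsub>group_ring G\<^esub> y \<in> carrier (group_ring G)"
      by (auto simp: group_ring_def subset_iff dest!: subsetD[OF keys_frag_extend] split: if_splits)
  next
    fix x assume "x \<in> carrier (group_ring G)"
    then have k: "Poly_Mapping.keys x \<subseteq> carrier G" by (simp add: group_ring_def)
    show "\<exists>y\<in>carrier (group_ring G). y \<oplus>\<^bsub>group_ring G\<^esub> x = \<zero>\<^bsub>group_ring G\<^esub>"
      using k by (intro bexI[of _ "- x"]) (auto simp: group_ring_def)
    show "\<one>\<^bsub>group_ring G\<^esub> \<otimes>\<^bsub>group_ring G\<^esub> x = x"
      using k by (auto simp: group_ring_def frag_expansion[symmetric]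
          cong: frag_extend_eq intro!: trans[OF frag_extend_eq frag_expansion[symmetric]])
    show "x \<otimes>\<^bsub>group_ring G\<^esub> \<one>\<^bsub>group_ring G\<^esub> = x"
      using k by (auto simp: group_ring_def intro!: trans[OF frag_extend_eq frag_expansion[symmetric]])
  next
    fix x y z assume "x \<in> carrier (group_ring G)" "y \<in> carrier (group_ring G)" "z \<in> carrier (group_ring G)"
    then show "(x \<otimes>\<^bsub>group_ring G\<^esub> y) \<otimes>\<^bsub>group_ring G\<^esub> z = x \<otimes>\<^bsub>group_ring G\<^esub> (y \<otimes>\<^bsub>group_ring G\<^esub> z)"
      by (simp add: group_ring_def) (rule frag_bilinear_assoc[where S = "carrier G"], auto simp: m_assoc)
  qed (auto simp: group_ring_def frag_extend_add frag_extend_fun_add ac_simps dest!: subsetD[OF Poly_Mapping.keys_add])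
qed

lemma left_module_free_module:
  assumes "ring R"
  shows "left_module R (free_module R S)"
proof -
  interpret ring R by fact
  let ?F = "free_module R S"
  have ag: "abelian_group ?F"
  proof (intro abelian_groupI)
    fix f g assume "f \<in> carrier ?F" "g \<in> carrier ?F"
    then show "f \<oplus>\<^bsub>?F\<^esub> g \<in> carrier ?F"
      by (auto simp: free_module_def intro: finite_subset[of _ "{s \<in> S. f s \<noteq> \<zero>\<^bsub>R\<^esub>} \<union> {s \<in> S. g s \<noteq> \<zero>\<^bsub>R\<^esub>}"])
  next
    fix f assume f: "f \<in> carrier ?F"
    then show "\<exists>g\<in>carrier ?F. g \<oplus>\<^bsub>?F\<^esub> f = \<zero>\<^bsub>?F\<^esub>"
      by (intro bexI[of _ "\<lambda>s\<in>S. \<ominus>\<^bsub>R\<^esub> f s"])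
        (auto simp: free_module_def l_neg PiE_iff fun_eq_iff restrict_def extensional_def elim!: rev_finite_subset)
  qed (auto simp: free_module_def fun_eq_iff PiE_iff restrict_def extensional_def a_ac cong: conj_cong)
  show ?thesis
    by (intro left_module.intro left_module_axioms.intro ag assms)
      (auto simp: free_module_def fun_eq_iff PiE_iff restrict_def extensional_def l_distr r_distr m_assoc
        elim!: rev_finite_subset)
qed

lemma mat2_eq_iff: "(A :: mat2) = B \<longleftrightarrow> A$1$1 = B$1$1 \<and> A$1$2 = B$1$2 \<and> A$2$1 = B$2$1 \<and> A$2$2 = B$2$2"
  by (auto simp: vec_eq_iff forall_2)

lemma mat2_mult_nth: "((A :: mat2) ** B)$i$j = A$i$1 * B$1$j + A$i$2 * B$2$j"
  by (simp add: matrix_matrix_mult_def sum_2)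

lemma moebius_mult:
  assumes "det A \<noteq> 0" "det B \<noteq> 0"
  shows "moebius (A ** B) c = moebius A (moebius B c)"
proof -
  define p :: "rat \<Rightarrow> rat \<Rightarrow> cusp" where "p u v = (if v = 0 then Infty else Fin (u / v))" for u v
  have p: "moebius M (p u v) = p (M$1$1 * u + M$1$2 * v) (M$2$1 * u + M$2$2 * v)"
    if "u \<noteq> 0 \<or> v \<noteq> 0" for M u v
  proof (cases "v = 0")
    case False
    have e: "M$i$1 * (u / v) + M$i$2 = (M$i$1 * u + M$i$2 * v) / v" for i
      using False by (simp add: field_simps)
    show ?thesis using False by (simp add: p_def e del: times_divide_eq_right)
  qed (use that in \<open>simp add: p_def\<close>)
  obtain u v where c: "c = p u v" "u \<noteq> 0 \<or> v \<noteq> 0"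
  proof (cases c)
    case Infty then show ?thesis using that[of 1 0] by (simp add: p_def)
  next
    case (Fin q) then show ?thesis using that[of q 1] by (simp add: p_def)
  qed
  have "B$1$1 * u + B$1$2 * v \<noteq> 0 \<or> B$2$1 * u + B$2$2 * v \<noteq> 0"
  proof (rule ccontr)
    assume "\<not> ?thesis"
    moreover have "det B * u = B$2$2 * (B$1$1 * u + B$1$2 * v) - B$1$2 * (B$2$1 * u + B$2$2 * v)"
      "det B * v = B$1$1 * (B$2$1 * u + B$2$2 * v) - B$2$1 * (B$1$1 * u + B$1$2 * v)"
      by (simp_all add: det_2 algebra_simps)
    ultimately show False using assms c by simp
  qed
  then show ?thesis using c by (simp add: p mat2_mult_nth algebra_simps)
qed

lemma moebius_uminus: "moebius (- A) c = moebius A c"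
proof (cases c)
  case (Fin q)
  have "(- A)$i$1 * q + (- A)$i$2 = - (A$i$1 * q + A$i$2)" for i by simp
  then show ?thesis unfolding Fin moebius.simps by (simp only: minus_divide_divide neg_equal_0_iff_equal)
qed simp

lemma mat_1_nth_Ints: "(mat 1 :: mat2)$i$j \<in> \<int>"
  by (simp add: mat_def)

lemma group_SL2Z: "group SL2Z"
proof (rule groupI)
  fix A assume A: "A \<in> carrier SL2Z"
  let ?B = "mat22 (A$2$2) (- (A$1$2)) (- (A$2$1)) (A$1$1)"
  have "?B \<in> carrier SL2Z" using A by (auto simp: SL2Z_def det_2 forall_2 mult.commute)
  moreover have "?B ** A = mat 1" using A
    by (auto simp: SL2Z_def det_2 mat2_eq_iff mat2_mult_nth mat_def algebra_simps)
  ultimately show "\<exists>B\<in>carrier SL2Z. B \<otimes>\<^bsub>SL2Z\<^esub> A = \<one>\<^bsub>SL2Z\<^esub>"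
    by (auto simp: SL2Z_def)
qed (auto simp: SL2Z_def det_mul mat2_mult_nth matrix_mul_assoc mat_1_nth_Ints)

lemma normal_pm_one: "{mat 1, - mat 1} \<lhd> SL2Z"
proof -
  interpret group SL2Z by (rule group_SL2Z)
  have [simp]: "(- A) ** B = - (A ** B)" "A ** (- B) = - (A ** B)" for A B :: mat2
    by (simp_all add: mat2_eq_iff mat2_mult_nth)
  have c: "mat 1 \<in> carrier SL2Z" "- mat 1 \<in> carrier SL2Z"
    by (auto simp: SL2Z_def mat_def det_2)
  have "inv\<^bsub>SL2Z\<^esub> (mat 1) = mat 1" "inv\<^bsub>SL2Z\<^esub> (- mat 1) = - mat 1"
    by (rule inv_equality; use c in \<open>simp add: SL2Z_def\<close>)+
  then have "subgroup {mat 1, - mat 1} SL2Z"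
    using c by (intro subgroupI) (auto simp: SL2Z_def)
  then show ?thesis
    by (rule normalI) (auto simp: r_coset_def l_coset_def SL2Z_def)
qed

lemma group_PSL2Z: "group PSL2Z"
  unfolding PSL2Z_def using normal_pm_one by (rule normal.factorgroup_is_group)

lemma psl_class_eq: "psl_class A = {A, - A}"
  by (auto simp: psl_class_def r_coset_def SL2Z_def mat2_eq_iff mat2_mult_nth mat_def)

lemma carrier_PSL2Z: "carrier PSL2Z = psl_class ` carrier SL2Z"
  by (auto simp: PSL2Z_def carrier_FactGroup psl_class_def)

lemma psl_act_class: "psl_act (psl_class A) c = moebius A c"
  by (simp add: psl_act_def psl_class_eq moebius_uminus)

lemma psl_class_mult:
  assumes "A \<in> carrier SL2Z" "B \<in> carrier SL2Z"
  shows "psl_class A \<otimes>\<^bsub>PSL2Z\<^esub> psl_class B = psl_class (A ** B)"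
  using normal.rcos_sum[OF normal_pm_one assms] by (simp add: PSL2Z_def psl_class_def SL2Z_def)

lemma psl_act_mult:
  assumes "g \<in> carrier PSL2Z" "h \<in> carrier PSL2Z"
  shows "psl_act (g \<otimes>\<^bsub>PSL2Z\<^esub> h) c = psl_act g (psl_act h c)"
proof -
  obtain A B where *: "A \<in> carrier SL2Z" "B \<in> carrier SL2Z" "g = psl_class A" "h = psl_class B"
    using assms by (auto simp: carrier_PSL2Z)
  then have "det A \<noteq> 0" "det B \<noteq> 0" by (auto simp: SL2Z_def)
  with * show ?thesis by (simp add: psl_class_mult psl_act_class moebius_mult)
qed

lemma psl_act_one: "psl_act \<one>\<^bsub>PSL2Z\<^esub> c = c"
proof -
  have "\<one>\<^bsub>PSL2Z\<^esub> = psl_class (mat 1)" by (simp add: PSL2Z_def psl_class_eq)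
  then show ?thesis by (cases c) (simp_all add: psl_act_class mat_def)
qed

lemma divisor_degree_frag_extend:
  "frag_extend (\<lambda>_. frag_of ()) D = frag_cmul (divisor_degree D) (frag_of ())"
  by (simp add: frag_extend_def divisor_degree_def poly_mapping_eq_iff fun_eq_iff lookup_sum)

lemma divisor_degree_eq_0_iff: "divisor_degree D = 0 \<longleftrightarrow> frag_extend (\<lambda>_. frag_of ()) D = 0"
  by (simp add: divisor_degree_frag_extend)

lemma left_module_Delta0:
  assumes "subgroup H PSL2Z"
  shows "left_module (group_ring (PSL2Z\<lparr>carrier := H\<rparr>)) Delta0"
proof -
  interpret group PSL2Z by (rule group_PSL2Z)
  have H: "g \<in> carrier PSL2Z" if "g \<in> H" for g using that assms by (rule subgroup.mem_carrier[rotated])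
  have ring: "ring (group_ring (PSL2Z\<lparr>carrier := H\<rparr>))"
    using assms by (intro ring_group_ring subgroup_imp_group)
  have ag: "abelian_group Delta0"
  proof (intro abelian_groupI)
    fix D assume "D \<in> carrier Delta0"
    then show "\<exists>D'\<in>carrier Delta0. D' \<oplus>\<^bsub>Delta0\<^esub> D = \<zero>\<^bsub>Delta0\<^esub>"
      by (intro bexI[of _ "- D"]) (auto simp: Delta0_def divisor_degree_eq_0_iff frag_extend_minus)
  qed (auto simp: Delta0_def divisor_degree_eq_0_iff frag_extend_add ac_simps)
  have act: "frag_extend (\<lambda>_. frag_of ()) (frag_extend (\<lambda>c. frag_of (psl_act g c)) D) =
      frag_extend (\<lambda>_. frag_of ()) D" for g D
    using frag_extend_compose[of "\<lambda>_. frag_of ()" "psl_act g" D] by (simp add: o_def)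
  have closed: "frag_extend (\<lambda>_. frag_of ()) (frag_extend (\<lambda>g. frag_extend (\<lambda>c. frag_of (psl_act g c)) D) x) = 0"
    if "frag_extend (\<lambda>_. frag_of ()) D = 0" for x D
    using subset_UNIV[of "Poly_Mapping.keys x"]
    by (induction x rule: frag_induction) (simp_all add: act that frag_extend_diff)
  show ?thesis
  proof (intro left_module.intro left_module_axioms.intro ag ring)
    fix x y D assume "x \<in> carrier (group_ring (PSL2Z\<lparr>carrier := H\<rparr>))"
      "y \<in> carrier (group_ring (PSL2Z\<lparr>carrier := H\<rparr>))" "D \<in> carrier Delta0"
    then show "(x \<otimes>\<^bsub>group_ring (PSL2Z\<lparr>carrier := H\<rparr>)\<^esub> y) \<odot>\<^bsub>Delta0\<^esub> D = x \<odot>\<^bsub>Delta0\<^esub> (y \<odot>\<^bsub>Delta0\<^esub> D)"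
      by (simp add: group_ring_def Delta0_def)
        (rule frag_bilinear_assoc[where S = H], auto simp: H psl_act_mult)
  next
    fix D
    show "\<one>\<^bsub>group_ring (PSL2Z\<lparr>carrier := H\<rparr>)\<^esub> \<odot>\<^bsub>Delta0\<^esub> D = D"
      by (simp add: group_ring_def Delta0_def psl_act_one frag_expansion[symmetric])
  qed (auto simp: Delta0_def group_ring_def divisor_degree_eq_0_iff closed frag_extend_add frag_extend_fun_add)
qed

lemma (in extended_farey_symbol) left_modules:
  "left_module (group_ring (farey_group V star mu)) Delta0"
  "left_module (group_ring (farey_group V star mu)) (free_module (group_ring (farey_group V star mu)) S)"
proof -
  interpret group PSL2Z by (rule group_PSL2Z)
  have "gluing_class star mu ` V \<subseteq> carrier PSL2Z"
    using gluing_integral by (auto simp: gluing_class_def carrier_PSL2Z)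
  then have H: "subgroup (generate PSL2Z (gluing_class star mu ` V)) PSL2Z"
    by (rule generate_is_subgroup)
  show "left_module (group_ring (farey_group V star mu)) Delta0"
    unfolding farey_group_def by (rule left_module_Delta0[OF H])
  show "left_module (group_ring (farey_group V star mu)) (free_module (group_ring (farey_group V star mu)) S)"
    unfolding farey_group_def by (intro left_module_free_module ring_group_ring subgroup_imp_group H)
qed

end

theory Submission
  imports Defs
begin

text \<open>
  Place a cusp \<open>c\<close> that is not a vertex of the polygon at infinity. The vertices become rational
  numbers, the side \<open>b\<close> separating \<open>c\<close> from the polygon joins the largest to the smallest of them,
  and it is therefore longer than every other side. As the length of an arc in this coordinate is
  a \<open>PSL\<^sub>2(\<int>)\<close>-invariant of the arc and \<open>c\<close>, and the reciprocal lengths have bounded denominators, replacing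
  \<open>c\<close> by its image under the inverse of the gluing of \<open>b\<close> is a descent that ends at a vertex.

  The descent shows at once that the sides generate \<open>\<Delta>\<^sub>0\<close>. For the relations, it is used to define by
  recursion a potential \<open>\<psi>\<close> on the cusps with values in chains of symbols \<open>[g, a]\<close> such that,
  modulo the Farey relations, \<open>\<psi>(\<gamma> x) = \<gamma> \<psi>(x) + \<kappa>(\<gamma>)\<close>. It suffices to check this for the gluings:
  for each \<open>x\<close> one of \<open>x\<close>, \<open>\<gamma>\<^sub>a x\<close> lies behind the side at which the recursion crosses.
  Hence \<open>\<psi>(g s) - \<psi>(g r) = [g, a]\<close> for \<open>a = (r, s)\<close>, and \<open>\<psi>\<close> extends linearly to an inverse of
  the boundary map modulo the relations.
\<close>

section \<open>Orientation and distance of cusps and arcs\<close>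

text \<open>Prescribing a cocycle on \<open>\<Gamma>\<close> by its values on the gluings would
  require the relations between the gluings. A function defined on the cusps avoids this: for each
  group element only the existence of some correction is proved, and since it cancels in differences
  of \<psi>, its dependence on a word in the gluings never has to be discussed. Each Farey relation
  enters at one place. The boundary relation says that the symbols sum to zero around the polygon,
  so that a potential exists on the vertices. The gluing of \<open>a\<close> carries the two ends of
  \<open>star a\<close> to the ends of \<open>a\<close>: one end defines \<open>\<kappa> a\<close>,
  the other requires that \<open>a\<close> plus the translate of \<open>star a\<close> vanish, which
  for an elliptic side of order 2 is its relation. For order 3 the elliptic relation is the cocycle
  condition of the cube of the gluing. Three copies of the polygon surround a triangle at such a
  side, and this is the source of the extra cases. Everything is compared modulo a set
  \<open>N\<close> of chains instead of in a quotient, so that the recursion can produce honest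
  chains.\<close>

lemma sgn_divide_pos: "y > 0 \<Longrightarrow> sgn (x / y) = sgn x" for x y :: rat
  by (simp add: sgn_if zero_less_divide_iff)

definition cusp_det :: "cusp \<Rightarrow> cusp \<Rightarrow> int" where
  "cusp_det c d = fst (cusp_coords c) * snd (cusp_coords d) - fst (cusp_coords d) * snd (cusp_coords c)"

text \<open>Positive iff \<open>c\<close> lies on the left of \<open>a\<close>; the sign choices in \<open>cusp_coords\<close> cancel.\<close>

definition orient :: "arc \<Rightarrow> cusp \<Rightarrow> int" where
  "orient a c = cusp_det (fst a) (snd a) * cusp_det (snd a) c * cusp_det c (fst a)"

text \<open>The Euclidean product of the coordinate vectors. Sending \<open>v\<close> to the vector
  with entries \<open>cusp_dot v c\<close> and \<open>cusp_det c v\<close> is linear of determinant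
  \<open>cusp_dot c c\<close> and takes \<open>c\<close> to infinity; dividing the first entry by
  \<open>cusp_dot c c\<close> makes the determinant 1. No matrix in SL2(Z) moving \<open>c\<close>
  to infinity has to be chosen.\<close>

definition cusp_dot :: "cusp \<Rightarrow> cusp \<Rightarrow> int" where
  "cusp_dot c d = fst (cusp_coords c) * fst (cusp_coords d) + snd (cusp_coords c) * snd (cusp_coords d)"

text \<open>The affine coordinate of \<open>v\<close> after moving \<open>c\<close> to infinity.\<close>

definition coord_at :: "cusp \<Rightarrow> cusp \<Rightarrow> rat" where
  "coord_at c v = of_int (cusp_dot v c) / (of_int (cusp_det c v) * of_int (cusp_dot c c))"

text \<open>The reciprocal of the length of \<open>a\<close> in the coordinate \<open>coord_at c\<close>, and \<open>0\<close> if \<open>c\<close> is an end of \<open>a\<close>.\<close>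

definition arc_dist :: "arc \<Rightarrow> cusp \<Rightarrow> rat" where
  "arc_dist a c = \<bar>of_int (cusp_det (fst a) c * cusp_det (snd a) c)\<bar> / \<bar>of_int (cusp_det (fst a) (snd a))\<bar>"

lemma cusp_det_commute: "cusp_det c d = - cusp_det d c"
  by (simp add: cusp_det_def)

lemma cusp_det_self [simp]: "cusp_det c c = 0"
  by (simp add: cusp_det_def)

lemma cusp_det_eq_0_iff: "cusp_det c d = 0 \<longleftrightarrow> c = d"
proof
  assume "cusp_det c d = 0"
  obtain x z y t where c: "cusp_coords c = (x, z)" and d: "cusp_coords d = (y, t)"
    by (metis surj_pair)
  have "(x = y \<and> z = t) \<or> (x = - y \<and> z = - t)"
    using \<open>cusp_det c d = 0\<close> c d
    by (intro coprime_eq_up_to_sign cusp_coords_coprime[OF c] cusp_coords_coprime[OF d])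
      (simp add: cusp_det_def)
  then show "c = d"
    using cusp_coords_value[OF c] cusp_coords_value[OF d] by auto
qed simp

lemma cusp_dot_self_pos: "cusp_dot c c > 0"
proof -
  obtain x z where c: "cusp_coords c = (x, z)" by fastforce
  have "x \<noteq> 0 \<or> z \<noteq> 0" using cusp_coords_coprime[OF c] by auto
  then show ?thesis unfolding cusp_dot_def c
    by (auto simp: sum_squares_gt_zero_iff)
qed

lemma orient_eq_0_iff:
  assumes "fst a \<noteq> snd a"
  shows "orient a c = 0 \<longleftrightarrow> c = fst a \<or> c = snd a"
  using assms by (auto simp: orient_def cusp_det_eq_0_iff)

lemma orient_swap: "orient (prod.swap a) c = - orient a c"
  by (cases a) (simp add: orient_def cusp_det_def algebra_simps)

lemma arc_dist_swap: "arc_dist (prod.swap a) c = arc_dist a c"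
proof -
  have "\<bar>cusp_det (snd a) (fst a)\<bar> = \<bar>cusp_det (fst a) (snd a)\<bar>"
    using cusp_det_commute[of "snd a" "fst a"] by simp
  then show ?thesis by (simp add: arc_dist_def mult.commute flip: of_int_abs)
qed

text \<open>The linear map behind \<open>coord_at c\<close> has determinant 1, so the images of
  \<open>v\<close> and \<open>w\<close> still have determinant \<open>cusp_det v w\<close>; the
  denominator is, up to sign, the product of their second entries.\<close>

lemma coord_at_diff:
  assumes "v \<noteq> c" "w \<noteq> c"
  shows "coord_at c w - coord_at c v = of_int (cusp_det v w) / of_int (cusp_det w c * cusp_det c v)"
proof -
  have nz: "cusp_det c v \<noteq> 0" "cusp_det c w \<noteq> 0" "cusp_dot c c \<noteq> 0"
    using assms cusp_dot_self_pos[of c] by (auto simp: cusp_det_eq_0_iff)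
  have "cusp_dot w c * cusp_det c v - cusp_dot v c * cusp_det c w = - cusp_det v w * cusp_dot c c"
    by (simp add: cusp_dot_def cusp_det_def algebra_simps)
  then have *: "of_int (cusp_dot w c) * of_int (cusp_det c v) - of_int (cusp_dot v c) * of_int (cusp_det c w)
      = (- of_int (cusp_det v w) * of_int (cusp_dot c c) :: rat)"
    by (simp flip: of_int_mult of_int_diff of_int_minus)
  have r: "(p / (b * k) - q / (a * k)) = e / (- b * a)"
    if "p * a - q * b = - e * k" "a \<noteq> 0" "b \<noteq> 0" "k \<noteq> 0" for p q a b e k :: rat
  proof -
    have "p / (b * k) - q / (a * k) = (p * a - q * b) / (a * b * k)"
      using that by (simp add: field_simps)
    also have "\<dots> = - e / (a * b)" using that by simp
    finally show ?thesis by (simp add: mult.commute)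
  qed
  show ?thesis unfolding coord_at_def of_int_mult
    using r[OF *] nz cusp_det_commute[of w c] by simp
qed

text \<open>The difference of the coordinates of the two ends is \<open>orient a c\<close> divided
  by a square.\<close>

lemma orient_coord_at:
  assumes "fst a \<noteq> c" "snd a \<noteq> c"
  shows "orient a c > 0 \<longleftrightarrow> coord_at c (fst a) < coord_at c (snd a)"
    and "orient a c < 0 \<longleftrightarrow> coord_at c (snd a) < coord_at c (fst a)"
proof -
  let ?k = "cusp_det (snd a) c * cusp_det c (fst a)"
  have k: "?k \<noteq> 0" using assms by (auto simp: cusp_det_eq_0_iff)
  have "coord_at c (snd a) - coord_at c (fst a) = of_int (orient a c) / (of_int ?k)\<^sup>2"
    unfolding coord_at_diff[OF assms] orient_def using k
    by (simp add: power2_eq_square field_simps)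
  moreover have "(of_int ?k)\<^sup>2 > (0::rat)" using k by (simp only: zero_less_power2 of_int_eq_0_iff) simp
  ultimately have "sgn (coord_at c (snd a) - coord_at c (fst a)) = sgn (of_int (orient a c))"
    by (simp only: sgn_divide_pos)
  then show "orient a c > 0 \<longleftrightarrow> coord_at c (fst a) < coord_at c (snd a)"
    "orient a c < 0 \<longleftrightarrow> coord_at c (snd a) < coord_at c (fst a)"
    by (auto simp: sgn_if split: if_splits)
qed

text \<open>The three differences in \<open>d\<close> add up to zero, so \<open>d < 0\<close> says
  that \<open>r\<close>, \<open>s\<close>, \<open>v\<close> have cyclically increasing coordinates.
  Up to a positive square, \<open>d\<close> is minus the product of determinants in
  \<open>orient\<close>.\<close>

lemma orient_coord_at3:
  assumes "r \<noteq> c" "s \<noteq> c" "v \<noteq> c"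
  defines "d \<equiv> (coord_at c s - coord_at c r) * (coord_at c v - coord_at c s) * (coord_at c r - coord_at c v)"
  shows "orient (r, s) v > 0 \<longleftrightarrow> d < 0" and "orient (r, s) v < 0 \<longleftrightarrow> d > 0"
proof -
  let ?r = "of_int (cusp_det c r) :: rat" and ?s = "of_int (cusp_det c s) :: rat" and ?v = "of_int (cusp_det c v) :: rat"
  have k: "?r \<noteq> 0" "?s \<noteq> 0" "?v \<noteq> 0" using assms by (auto simp: cusp_det_eq_0_iff)
  have "d = - of_int (orient (r, s) v) / (?r * ?s * ?v)\<^sup>2"
    unfolding d_def using assms k
    by (simp add: coord_at_diff orient_def cusp_det_commute[of _ c] power2_eq_square field_simps)
  moreover have "(?r * ?s * ?v)\<^sup>2 > 0" using k by (simp add: zero_less_power2)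
  ultimately have "sgn d = sgn (- of_int (orient (r, s) v))"
    by (simp only: sgn_divide_pos)
  then show "orient (r, s) v > 0 \<longleftrightarrow> d < 0" "orient (r, s) v < 0 \<longleftrightarrow> d > 0"
    by (auto simp: sgn_if split: if_splits)
qed

lemma arc_dist_coord_at:
  assumes "fst a \<noteq> c" "snd a \<noteq> c"
  shows "arc_dist a c = inverse \<bar>coord_at c (snd a) - coord_at c (fst a)\<bar>"
  unfolding coord_at_diff[OF assms] arc_dist_def cusp_det_commute[of c]
  by (simp add: abs_mult mult.commute)

lemma arc_dist_less:
  assumes "fst a \<noteq> c" "snd a \<noteq> c" "fst b \<noteq> c" "snd b \<noteq> c" "fst a \<noteq> snd a"
    and "\<bar>coord_at c (snd a) - coord_at c (fst a)\<bar> < \<bar>coord_at c (snd b) - coord_at c (fst b)\<bar>"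
  shows "arc_dist b c < arc_dist a c"
proof -
  have "orient a c \<noteq> 0" using assms orient_eq_0_iff by metis
  then have "coord_at c (snd a) - coord_at c (fst a) \<noteq> 0"
    using orient_coord_at[OF assms(1,2)] by auto
  then show ?thesis using assms by (simp add: arc_dist_coord_at less_imp_inverse_less)
qed

lemma arc_dist_nonneg: "arc_dist a c \<ge> 0"
  by (simp add: arc_dist_def)

lemma arc_dist_eq_0_iff: "fst a \<noteq> snd a \<Longrightarrow> arc_dist a c = 0 \<longleftrightarrow> c = fst a \<or> c = snd a"
  by (auto simp: arc_dist_def cusp_det_eq_0_iff)

text \<open>In the coordinate at \<open>c\<close> the three directed sides add up to zero, and by
  the orientation one of them is positive and two are negative. The positive one is the side beyond
  which \<open>c\<close> lies; its length is the sum of the other two lengths, so its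
  \<open>arc_dist\<close> is the smallest.\<close>

lemma triangle_orient:
  assumes "orient (r, s) t < 0" "c \<notin> {r, s, t}"
  shows "orient (r, s) c > 0 \<and> orient (s, t) c < 0 \<and> orient (t, r) c < 0 \<and>
           arc_dist (r, s) c < arc_dist (s, t) c \<and> arc_dist (r, s) c < arc_dist (t, r) c \<or>
         orient (r, s) c < 0 \<and> orient (s, t) c > 0 \<and> orient (t, r) c < 0 \<and>
           arc_dist (s, t) c < arc_dist (r, s) c \<and> arc_dist (s, t) c < arc_dist (t, r) c \<or>
         orient (r, s) c < 0 \<and> orient (s, t) c < 0 \<and> orient (t, r) c > 0 \<and>
           arc_dist (t, r) c < arc_dist (r, s) c \<and> arc_dist (t, r) c < arc_dist (s, t) c"
proof -
  define R S T where d: "R = coord_at c r" "S = coord_at c s" "T = coord_at c t"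
  have ne: "r \<noteq> s" "s \<noteq> t" "t \<noteq> r" using assms(1) by (auto simp: orient_def)
  have nc: "r \<noteq> c" "s \<noteq> c" "t \<noteq> c" using assms(2) by auto
  have "(S - R) * (T - S) * (R - T) > 0"
    using assms(1) nc unfolding d by (simp add: orient_coord_at3)
  then have "R < T \<and> T < S \<or> S < R \<and> R < T \<or> S < R \<and> T < S"
    by (cases "R < S"; cases "S < T"; cases "T < R") (auto simp: zero_less_mult_iff mult_less_0_iff)
  moreover have "arc_dist (r, s) c = inverse \<bar>S - R\<bar>" "arc_dist (s, t) c = inverse \<bar>T - S\<bar>"
    "arc_dist (t, r) c = inverse \<bar>R - T\<bar>"
    using nc by (simp_all add: arc_dist_coord_at d)
  moreover have "orient (r, s) c > 0 \<longleftrightarrow> R < S" "orient (r, s) c < 0 \<longleftrightarrow> S < R"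
    "orient (s, t) c > 0 \<longleftrightarrow> S < T" "orient (s, t) c < 0 \<longleftrightarrow> T < S"
    "orient (t, r) c > 0 \<longleftrightarrow> T < R" "orient (t, r) c < 0 \<longleftrightarrow> R < T"
    using nc by (simp_all add: orient_coord_at d)
  moreover have "inverse \<bar>y\<bar> < inverse \<bar>x\<bar>" if "x \<noteq> 0" "\<bar>x\<bar> < \<bar>y\<bar>" for x y :: rat
    using that by (simp add: less_imp_inverse_less)
  ultimately show ?thesis by (elim disjE) auto
qed

section \<open>Orientation and distance under integral transformations\<close>

lemma moebius_coords:
  assumes "det A \<noteq> 0"
  obtains k :: rat where "k \<noteq> 0"
    "of_int (fst (cusp_coords (moebius A c))) = k * (A$1$1 * of_int (fst (cusp_coords c)) + A$1$2 * of_int (snd (cusp_coords c)))"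
    "of_int (snd (cusp_coords (moebius A c))) = k * (A$2$1 * of_int (fst (cusp_coords c)) + A$2$2 * of_int (snd (cusp_coords c)))"
proof -
  obtain x z where xz: "cusp_coords c = (x, z)" by fastforce
  obtain y t where yt: "cusp_coords (moebius A c) = (y, t)" by fastforce
  define u where "u = A$1$1 * of_int x + A$1$2 * of_int z"
  define v where "v = A$2$1 * of_int x + A$2$2 * of_int z"
  have xz0: "x \<noteq> 0 \<or> z \<noteq> 0" and yt0: "y \<noteq> 0 \<or> t \<noteq> 0"
    using cusp_coords_coprime[OF xz] cusp_coords_coprime[OF yt] by auto
  have uv: "u \<noteq> 0 \<or> v \<noteq> 0"
  proof (rule ccontr)
    assume "\<not> ?thesis"
    moreover have "det A * of_int x = A$2$2 * u - A$1$2 * v" "det A * of_int z = A$1$1 * v - A$2$1 * u"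
      by (simp_all add: det_2 u_def v_def algebra_simps)
    ultimately show False using assms xz0 by simp
  qed
  have "moebius A c = (if v = 0 then Infty else Fin (u / v))"
  proof (cases "z = 0")
    case True
    then show ?thesis using cusp_coords_value[OF xz] xz0 by (simp add: u_def v_def)
  next
    case False
    have e: "A$i$1 * (of_int x / of_int z) + A$i$2 = (A$i$1 * of_int x + A$i$2 * of_int z) / of_int z" for i
      using False by (simp add: field_simps)
    show ?thesis using cusp_coords_value[OF xz] False by (simp add: e u_def v_def del: times_divide_eq_right)
  qed
  then have "(if v = 0 then Infty else Fin (u / v)) = (if t = 0 then Infty else Fin (of_int y / of_int t))"
    using cusp_coords_value[OF yt] by simp
  \<comment> \<open>The second coordinate determines the factor unless it vanishes, in which case
    the first one does.\<close>
  then have "\<exists>k. k \<noteq> 0 \<and> of_int y = k * u \<and> of_int t = k * v"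
    using uv yt0
    by (intro exI[of _ "if v = 0 then of_int y / u else of_int t / v"]) (auto simp: field_simps split: if_splits)
  then show ?thesis using that xz yt by (auto simp: u_def v_def)
qed

lemma moebius_cusp_det:
  assumes "det A \<noteq> 0"
  obtains k :: "cusp \<Rightarrow> rat" where "\<And>c. k c \<noteq> 0"
    "\<And>c d. of_int (cusp_det (moebius A c) (moebius A d)) = k c * k d * det A * of_int (cusp_det c d)"
proof -
  have "\<exists>k. \<forall>c. k c \<noteq> 0 \<and>
    of_int (fst (cusp_coords (moebius A c))) = k c * (A$1$1 * of_int (fst (cusp_coords c)) + A$1$2 * of_int (snd (cusp_coords c))) \<and>
    of_int (snd (cusp_coords (moebius A c))) = k c * (A$2$1 * of_int (fst (cusp_coords c)) + A$2$2 * of_int (snd (cusp_coords c)))"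
    by (rule choice) (metis moebius_coords[OF assms])
  then obtain k where k: "\<And>c. k c \<noteq> 0"
    "\<And>c. of_int (fst (cusp_coords (moebius A c))) = k c * (A$1$1 * of_int (fst (cusp_coords c)) + A$1$2 * of_int (snd (cusp_coords c)))"
    "\<And>c. of_int (snd (cusp_coords (moebius A c))) = k c * (A$2$1 * of_int (fst (cusp_coords c)) + A$2$2 * of_int (snd (cusp_coords c)))"
    by metis
  show ?thesis
    by (rule that[of k]) (auto simp: k cusp_det_def det_2 algebra_simps)
qed

text \<open>Each cusp occurs in two factors of \<open>orient\<close>, so the unknown scalings of the
  coordinate vectors enter as squares and only the cube of \<open>det A\<close> could contribute a
  sign.\<close>

lemma orient_moebius:
  assumes "det A > 0"
  shows "sgn (orient (moebius A r, moebius A s) (moebius A c)) = sgn (orient (r, s) c)"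
proof -
  obtain k where k: "\<And>c. k c \<noteq> 0"
    "\<And>c d. of_int (cusp_det (moebius A c) (moebius A d)) = k c * k d * det A * of_int (cusp_det c d)"
    using moebius_cusp_det[of A] assms by (metis less_irrefl)
  have "of_int (orient (moebius A r, moebius A s) (moebius A c)) =
      (k r * k s * k c)\<^sup>2 * det A ^ 3 * of_int (orient (r, s) c)"
    by (simp add: orient_def k power2_eq_square power3_eq_cube algebra_simps)
  moreover have "(k r * k s * k c)\<^sup>2 * det A ^ 3 > 0" using k assms by simp
  ultimately have "sgn (of_int (orient (moebius A r, moebius A s) (moebius A c))) = sgn (of_int (orient (r, s) c) :: rat)"
    by (metis sgn_mult sgn_pos mult_1)
  then show ?thesis by (auto simp: sgn_if split: if_splits)
qed

lemma orient_base: "of_int (sgn (orient (Infty, Fin 0) (Fin q))) = sgn q"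
proof -
  obtain n d where q: "quotient_of q = (n, d)" by fastforce
  have "d > 0" using q quotient_of_denom_pos by blast
  moreover have "q = of_int n / of_int d" using q by (rule quotient_of_div)
  moreover have "orient (Infty, Fin 0) (Fin q) = n * d" by (simp add: orient_def cusp_det_def q)
  ultimately show ?thesis by (simp add: sgn_mult sgn_divide_pos) (simp add: sgn_if)
qed

text \<open>Positive \<open>q\<close> translates the definition of \<open>left_cusps\<close> into
  \<open>orient\<close>; the value \<open>q = -1\<close> later locates the apex of a side of order
  3.\<close>

lemma orient_arc_matrix:
  assumes "r \<noteq> s"
  shows "of_int (sgn (orient (r, s) (moebius (arc_matrix (r, s)) (Fin q)))) = sgn q"
proof -
  have "represents_arc (arc_matrix (r, s)) (r, s)" using assms by (intro represents_arc_arc_matrix) simp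
  then have "det (arc_matrix (r, s)) > 0" "moebius (arc_matrix (r, s)) Infty = r"
    "moebius (arc_matrix (r, s)) (Fin 0) = s"
    by (simp_all add: represents_arc_def)
  then show ?thesis using orient_moebius[of "arc_matrix (r, s)" Infty "Fin 0" "Fin q"] orient_base[of q] by simp
qed

lemma left_cusps_orient:
  assumes "r \<noteq> s" "c \<in> left_cusps (r, s)"
  shows "orient (r, s) c > 0"
proof -
  obtain q where "q > 0" "c = moebius (arc_matrix (r, s)) (Fin q)"
    using assms(2) by (auto simp: left_cusps_def)
  then have "sgn (orient (r, s) c) = 1" using orient_arc_matrix[OF assms(1), of q] by simp
  then show ?thesis by (simp add: sgn_if split: if_splits)
qed

text \<open>An integral matrix of determinant 1 maps primitive vectors to primitive vectors. The
  scaling of the coordinates is therefore a sign, which the absolute values in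
  \<open>arc_dist\<close> remove.\<close>

lemma arc_dist_moebius:
  assumes "A \<in> carrier SL2Z"
  shows "arc_dist (moebius A r, moebius A s) (moebius A c) = arc_dist (r, s) c"
proof -
  have det: "det A = 1" and int: "A$i$j \<in> \<int>" for i j using assms by (auto simp: SL2Z_def)
  have "\<forall>i j. \<exists>b. A$i$j = of_int b" using int by (metis Ints_cases)
  then obtain B :: "2 \<Rightarrow> 2 \<Rightarrow> int" where B: "\<And>i j. A$i$j = of_int (B i j)"
    by metis
  have "of_int (B 1 1 * B 2 2 - B 1 2 * B 2 1) = (1 :: rat)" using det by (simp add: det_2 B)
  then have detB: "B 1 1 * B 2 2 - B 1 2 * B 2 1 = 1" by (simp only: of_int_eq_1_iff)
  have "\<forall>c. \<exists>e::int. \<bar>e\<bar> = 1 \<and>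
    fst (cusp_coords (moebius A c)) = e * (B 1 1 * fst (cusp_coords c) + B 1 2 * snd (cusp_coords c)) \<and>
    snd (cusp_coords (moebius A c)) = e * (B 2 1 * fst (cusp_coords c) + B 2 2 * snd (cusp_coords c))"
  proof
    fix c
    obtain x z where xz: "cusp_coords c = (x, z)" by fastforce
    obtain y t where yt: "cusp_coords (moebius A c) = (y, t)" by fastforce
    let ?u = "B 1 1 * x + B 1 2 * z" and ?v = "B 2 1 * x + B 2 2 * z"
    have "det A \<noteq> 0" using det by simp
    obtain k :: rat where k: "of_int y = k * of_int ?u" "of_int t = k * of_int ?v"
    proof (rule moebius_coords[OF \<open>det A \<noteq> 0\<close>, of c])
      fix k :: rat
      assume "of_int (fst (cusp_coords (moebius A c))) = k * (A$1$1 * of_int (fst (cusp_coords c)) + A$1$2 * of_int (snd (cusp_coords c)))"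
        "of_int (snd (cusp_coords (moebius A c))) = k * (A$2$1 * of_int (fst (cusp_coords c)) + A$2$2 * of_int (snd (cusp_coords c)))"
      then show thesis using that[of k] by (simp add: xz yt B)
    qed
    have "of_int (y * ?v) = (of_int (?u * t) :: rat)"
      unfolding of_int_mult k by simp
    then have eq: "y * ?v = ?u * t" by (simp only: of_int_eq_iff)
    have "coprime ?u ?v"
    proof (rule coprimeI)
      fix l assume l: "l dvd ?u" "l dvd ?v"
      have "B 2 2 * ?u - B 1 2 * ?v = (B 1 1 * B 2 2 - B 1 2 * B 2 1) * x"
        "B 1 1 * ?v - B 2 1 * ?u = (B 1 1 * B 2 2 - B 1 2 * B 2 1) * z"
        by (simp_all add: algebra_simps)
      then have "B 2 2 * ?u - B 1 2 * ?v = x" "B 1 1 * ?v - B 2 1 * ?u = z" by (simp_all only: detB mult_1)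
      moreover have "l dvd B 2 2 * ?u - B 1 2 * ?v" "l dvd B 1 1 * ?v - B 2 1 * ?u"
        by (rule dvd_diff; rule dvd_mult; rule l)+
      ultimately have "l dvd x" "l dvd z" by (simp_all only:)
      then show "is_unit l" using cusp_coords_coprime[OF xz] coprime_common_divisor by blast
    qed
    then have "(y = ?u \<and> t = ?v) \<or> (y = - ?u \<and> t = - ?v)"
      using eq coprime_eq_up_to_sign[OF cusp_coords_coprime[OF yt]] by blast
    then show "\<exists>e::int. \<bar>e\<bar> = 1 \<and>
      fst (cusp_coords (moebius A c)) = e * (B 1 1 * fst (cusp_coords c) + B 1 2 * snd (cusp_coords c)) \<and>
      snd (cusp_coords (moebius A c)) = e * (B 2 1 * fst (cusp_coords c) + B 2 2 * snd (cusp_coords c))"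
      unfolding xz yt fst_conv snd_conv
      by (elim disjE) (rule exI[of _ 1], simp, rule exI[of _ "-1"], simp)
  qed
  from choice[OF this] obtain e :: "cusp \<Rightarrow> int" where e: "\<And>c. \<bar>e c\<bar> = 1"
    "\<And>c. fst (cusp_coords (moebius A c)) = e c * (B 1 1 * fst (cusp_coords c) + B 1 2 * snd (cusp_coords c))"
    "\<And>c. snd (cusp_coords (moebius A c)) = e c * (B 2 1 * fst (cusp_coords c) + B 2 2 * snd (cusp_coords c))"
    by blast
  have "cusp_det (moebius A c) (moebius A d) = e c * e d * (B 1 1 * B 2 2 - B 1 2 * B 2 1) * cusp_det c d" for c d
    by (simp add: cusp_det_def e algebra_simps)
  then have "\<bar>cusp_det (moebius A c) (moebius A d)\<bar> = \<bar>cusp_det c d\<bar>" for c d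
    by (simp add: detB abs_mult e)
  then show ?thesis by (simp add: arc_dist_def abs_mult flip: of_int_abs)
qed

lemma psl_act_orient:
  assumes "g \<in> carrier PSL2Z"
  shows "sgn (orient (psl_act g r, psl_act g s) (psl_act g c)) = sgn (orient (r, s) c)"
  using assms by (auto simp: carrier_PSL2Z psl_act_class SL2Z_def intro!: orient_moebius)

lemma psl_act_arc_dist:
  assumes "g \<in> carrier PSL2Z"
  shows "arc_dist (psl_act g r, psl_act g s) (psl_act g c) = arc_dist (r, s) c"
  using assms by (auto simp: carrier_PSL2Z psl_act_class intro!: arc_dist_moebius)

lemma psl_act_inv:
  assumes "g \<in> carrier PSL2Z"
  shows "psl_act (inv\<^bsub>PSL2Z\<^esub> g) (psl_act g c) = c" "psl_act g (psl_act (inv\<^bsub>PSL2Z\<^esub> g) c) = c"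
proof -
  interpret group PSL2Z by (rule group_PSL2Z)
  show "psl_act (inv\<^bsub>PSL2Z\<^esub> g) (psl_act g c) = c" "psl_act g (psl_act (inv\<^bsub>PSL2Z\<^esub> g) c) = c"
    using assms by (simp_all add: psl_act_one flip: psl_act_mult)
qed

section \<open>The polygon and its gluings\<close>

lemma matrix_inv_mult:
  fixes A :: mat2
  assumes "det A \<noteq> 0"
  shows "A ** matrix_inv A = mat 1" "matrix_inv A ** A = mat 1"
proof -
  have "\<exists>B. A ** B = mat 1 \<and> B ** A = mat 1"
    using assms by (simp add: invertible_det_nz[symmetric] invertible_def)
  then have "A ** matrix_inv A = mat 1 \<and> matrix_inv A ** A = mat 1"
    unfolding matrix_inv_def by (rule someI_ex)
  then show "A ** matrix_inv A = mat 1" "matrix_inv A ** A = mat 1" by auto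
qed

lemma arc_matrix_props:
  assumes "fst a \<noteq> snd a"
  shows "det (arc_matrix a) > 0" "moebius (arc_matrix a) Infty = fst a" "moebius (arc_matrix a) (Fin 0) = snd a"
    "det (arc_matrix_neg a) > 0" "moebius (arc_matrix_neg a) Infty = snd a" "moebius (arc_matrix_neg a) (Fin 0) = fst a"
    "moebius (arc_matrix_neg a) (Fin 1) = moebius (arc_matrix a) (Fin (-1))"
    "arc_matrix a = arc_matrix_neg a ** mat22 0 1 (- 1) 0"
proof -
  let ?A = "arc_matrix a"
  show A: "det ?A > 0" "moebius ?A Infty = fst a" "moebius ?A (Fin 0) = snd a"
    using represents_arc_arc_matrix[OF assms] by (simp_all add: represents_arc_def)
  show "det (arc_matrix_neg a) > 0" using A by (simp add: arc_matrix_neg_def det_mul det_mat22)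
  have *: "moebius (arc_matrix_neg a) c = moebius ?A (moebius (mat22 0 (- 1) 1 0) c)" for c
    unfolding arc_matrix_neg_def using A by (intro moebius_mult) (auto simp: det_mat22)
  show "moebius (arc_matrix_neg a) Infty = snd a" "moebius (arc_matrix_neg a) (Fin 0) = fst a"
    "moebius (arc_matrix_neg a) (Fin 1) = moebius ?A (Fin (-1))"
    unfolding * using A by simp_all
  show "arc_matrix a = arc_matrix_neg a ** mat22 0 1 (- 1) 0"
    by (simp add: arc_matrix_neg_def mat2_eq_iff mat2_mult_nth)
qed

lemma polygon_sides_nth:
  "polygon_sides rs = (\<lambda>i. (rs ! i, rs ! (Suc i mod length rs))) ` {..<length rs}"
  by (auto simp: polygon_sides_def set_zip nth_rotate1 image_iff)

lemma polygon_sides_images: "fst ` polygon_sides rs = set rs" "snd ` polygon_sides rs = set rs"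
proof -
  have "fst ` set (zip rs (rotate1 rs)) = set (map fst (zip rs (rotate1 rs)))"
    "snd ` set (zip rs (rotate1 rs)) = set (map snd (zip rs (rotate1 rs)))"
    by (simp_all only: set_map)
  then show "fst ` polygon_sides rs = set rs" "snd ` polygon_sides rs = set rs"
    unfolding polygon_sides_def by (simp_all only: map_fst_zip map_snd_zip length_rotate1 set_rotate1)
qed

text \<open>A count: both maps are onto the \<open>length rs\<close> vertices, and there are at most
  that many sides.\<close>

lemma polygon_sides_inj:
  assumes "distinct rs"
  shows "inj_on fst (polygon_sides rs)" "inj_on snd (polygon_sides rs)"
proof -
  have "finite (polygon_sides rs)" by (simp add: polygon_sides_def)
  moreover have "card (polygon_sides rs) \<le> length rs"
    unfolding polygon_sides_nth using card_image_le[of "{..<length rs}"] by fastforce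
  moreover have "card (polygon_sides rs) \<ge> length rs"
    using card_image_le[OF \<open>finite (polygon_sides rs)\<close>, of fst] assms
    by (simp add: polygon_sides_images distinct_card)
  ultimately show "inj_on fst (polygon_sides rs)" "inj_on snd (polygon_sides rs)"
    using assms by (auto intro!: eq_card_imp_inj_on simp: polygon_sides_images distinct_card)
qed

text \<open>Partial sums of \<open>w\<close> along the boundary, starting at \<open>rs ! 0\<close>;
  only on the side closing the polygon is the increment wrong, by the total sum. The description of
  \<open>p v\<close> as a sum of values of \<open>w\<close> keeps \<open>p\<close> inside every
  additively closed set containing them.\<close>

lemma polygon_potential:
  fixes w :: "arc \<Rightarrow> 'm::ab_group_add"
  assumes "distinct rs"
  obtains p where "\<And>v. \<exists>B\<subseteq>polygon_sides rs. p v = sum w B"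
    "\<And>a. a \<in> polygon_sides rs \<Longrightarrow>
      p (snd a) - p (fst a) = w a \<or> p (snd a) - p (fst a) = w a - sum w (polygon_sides rs)"
proof -
  define n where "n = length rs"
  define side where "side i = (rs ! i, rs ! (Suc i mod n))" for i
  \<comment> \<open>The default index makes \<open>p\<close> the empty sum at cusps that are not
    vertices.\<close>
  define idx where "idx v = (if v \<in> set rs then SOME i. i < n \<and> rs ! i = v else 0)" for v
  define p where "p v = (\<Sum>i<idx v. w (side i))" for v
  have idx: "idx (rs ! i) = i" if "i < n" for i
  proof -
    have "\<exists>j. j < n \<and> rs ! j = rs ! i" using that by blast
    then have "idx (rs ! i) < n \<and> rs ! (idx (rs ! i)) = rs ! i"
      using someI_ex[of "\<lambda>j. j < n \<and> rs ! j = rs ! i"] that by (simp add: idx_def n_def)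
    then show ?thesis using nth_eq_iff_index_eq[OF assms] that unfolding n_def by blast
  qed
  have idx_le: "idx v \<le> n" for v
  proof (cases "v \<in> set rs")
    case True
    then show ?thesis using idx by (auto simp: in_set_conv_nth n_def)
  qed (simp add: idx_def)
  have sides: "polygon_sides rs = side ` {..<n}"
    unfolding polygon_sides_nth side_def n_def by simp
  have inj: "inj_on side {..<n}"
    using assms by (auto simp: inj_on_def side_def n_def nth_eq_iff_index_eq)
  have total: "sum w (polygon_sides rs) = (\<Sum>i<n. w (side i))"
    unfolding sides using inj by (simp add: sum.reindex)
  show ?thesis
  proof (rule that)
    fix v
    show "\<exists>B\<subseteq>polygon_sides rs. p v = sum w B"
      using idx_le[of v] inj_on_subset[OF inj, of "{..<idx v}"]
      by (intro exI[of _ "side ` {..<idx v}"]) (auto simp: sides p_def sum.reindex)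
  next
    fix a assume "a \<in> polygon_sides rs"
    then obtain i where i: "i < n" "a = side i" unfolding sides by auto
    show "p (snd a) - p (fst a) = w a \<or> p (snd a) - p (fst a) = w a - sum w (polygon_sides rs)"
    proof (cases "Suc i < n")
      case True
      then have "p (snd a) = p (fst a) + w a" unfolding i side_def p_def using i by (simp add: idx side_def)
      then show ?thesis by simp
    next
      case False
      then have n: "n = Suc i" using i by simp
      have "p (snd a) = 0" using i n idx[of 0] by (simp add: side_def p_def)
      moreover have "p (fst a) + w a = sum w (polygon_sides rs)"
        unfolding total p_def using i n by (simp add: side_def idx)
      ultimately show ?thesis by (simp add: algebra_simps)
    qed
  qed
qed

context extended_farey_symbol
begin

abbreviation glue :: "arc \<Rightarrow> mat2 set" where
  "glue \<equiv> gluing_class star mu"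

text \<open>The negation treats paired sides and elliptic sides of order 2 together: for
  \<open>star a = a\<close> the two gluing formulas coincide.\<close>

definition order3 :: "arc \<Rightarrow> bool" where
  "order3 a \<longleftrightarrow> star a = a \<and> mu a = 3"

lemma finite_V: "finite V"
  using polygon by (auto simp: polygon_sides_def)

lemma fst_snd_V: "fst ` V = snd ` V"
  using polygon polygon_sides_images by metis

lemma sum_fst_snd: "(\<Sum>a\<in>V. f (fst a)) = (\<Sum>a\<in>V. f (snd a))" for f :: "cusp \<Rightarrow> 'b::comm_monoid_add"
proof -
  have "inj_on fst V" "inj_on snd V"
    using polygon polygon_sides_inj by (auto simp: convex_ideal_polygon_def)
  then show ?thesis using sum.reindex[of fst V f] sum.reindex[of snd V f] by (simp add: fst_snd_V)
qed

lemma side_distinct: "a \<in> V \<Longrightarrow> fst a \<noteq> snd a"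
proof -
  assume "a \<in> V"
  obtain rs where rs: "distinct rs" "V = polygon_sides rs" "length rs \<ge> 3"
    using polygon by (auto simp: convex_ideal_polygon_def)
  obtain i where i: "i < length rs" "a = (rs ! i, rs ! (Suc i mod length rs))"
    using \<open>a \<in> V\<close> unfolding rs polygon_sides_nth by auto
  have "i \<noteq> Suc i mod length rs" using i rs(3) by (cases "Suc i = length rs") auto
  moreover have "Suc i mod length rs < length rs" using i by (intro mod_less_divisor) auto
  ultimately show ?thesis using i rs(1) by (simp add: nth_eq_iff_index_eq)
qed

lemma vertex_left:
  assumes "a \<in> V" "v \<in> fst ` V" "v \<noteq> fst a" "v \<noteq> snd a"
  shows "orient a v > 0"
proof -
  obtain rs where rs: "convex_ideal_polygon rs" "V = polygon_sides rs" using polygon by auto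
  have "v \<in> set rs" using assms rs polygon_sides_images by simp
  moreover have "set rs - {fst a, snd a} \<subseteq> left_cusps (fst a, snd a)"
    using rs assms(1) unfolding convex_ideal_polygon_def by (cases a) auto
  ultimately show ?thesis
    using left_cusps_orient[of "fst a" "snd a" v] side_distinct[OF assms(1)] assms by auto
qed

text \<open>A third vertex would lie on the left of both \<open>a\<close> and its reverse.\<close>

lemma side_reverse: "a \<in> V \<Longrightarrow> prod.swap a \<notin> V"
proof
  assume a: "a \<in> V" "prod.swap a \<in> V"
  obtain rs where rs: "distinct rs" "V = polygon_sides rs" "length rs \<ge> 3"
    using polygon by (auto simp: convex_ideal_polygon_def)
  have "card (fst ` V) \<ge> 3" using rs by (simp add: polygon_sides_images distinct_card)
  moreover have "card {fst a, snd a} \<le> 2" by (simp add: card_insert_if)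
  ultimately have "\<not> fst ` V \<subseteq> {fst a, snd a}"
    using card_mono[of "{fst a, snd a}" "fst ` V"] by auto
  then obtain v where v: "v \<in> fst ` V" "v \<noteq> fst a" "v \<noteq> snd a" by auto
  then have "orient a v > 0" "orient (prod.swap a) v > 0"
    using vertex_left[OF a(1)] vertex_left[OF a(2)] by auto
  then show False by (simp add: orient_swap)
qed

lemma side_of:
  assumes "c \<notin> fst ` V"
  obtains b where "b \<in> V" "orient b c < 0"
    "\<And>e. e \<in> V \<Longrightarrow> e \<noteq> b \<Longrightarrow> orient e c > 0 \<and> arc_dist b c < arc_dist e c"
proof -
  let ?x = "coord_at c"
  have nc: "fst a \<noteq> c" "snd a \<noteq> c" if "a \<in> V" for a using that assms fst_snd_V by auto
  have "V \<noteq> {}" using base_arc by auto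
  \<comment> \<open>Take the side that starts at the vertex of largest coordinate: its coordinate
    can only decrease towards the other end, which means that \<open>c\<close> is on its
    right.\<close>
  then have "Max ((\<lambda>a. ?x (fst a)) ` V) \<in> (\<lambda>a. ?x (fst a)) ` V"
    using finite_V by (intro Max_in) auto
  then obtain b where "b \<in> V" "Max ((\<lambda>a. ?x (fst a)) ` V) = ?x (fst b)" by auto
  then have b: "b \<in> V" "\<And>a. a \<in> V \<Longrightarrow> ?x (fst a) \<le> ?x (fst b)"
    using finite_V by (auto simp flip: \<open>Max _ = _\<close>)
  have le: "?x v \<le> ?x (fst b)" if "v \<in> fst ` V" for v using that b by auto
  have "orient b c \<noteq> 0" using nc b orient_eq_0_iff[OF side_distinct] by metis
  moreover have "\<not> orient b c > 0"
    using orient_coord_at(1)[OF nc[OF b(1)]] le[of "snd b"] b(1) fst_snd_V by auto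
  ultimately have neg: "orient b c < 0" by simp
  then have lt: "?x (snd b) < ?x (fst b)" using orient_coord_at(2)[OF nc[OF b(1)]] by simp
  have between: "?x (snd b) < ?x v \<and> ?x v < ?x (fst b)"
    if "v \<in> fst ` V" "v \<noteq> fst b" "v \<noteq> snd b" for v
  proof -
    have "v \<noteq> c" using that assms by auto
    have "orient (fst b, snd b) v > 0" using vertex_left[OF b(1) that] by simp
    then have "(?x (snd b) - ?x (fst b)) * (?x v - ?x (snd b)) * (?x (fst b) - ?x v) < 0"
      using orient_coord_at3(1)[OF nc[OF b(1)] \<open>v \<noteq> c\<close>] by simp
    then show ?thesis using lt le[OF that(1)]
      by (auto simp: mult_less_0_iff zero_less_mult_iff)
  qed
  have range: "?x (snd b) \<le> ?x v" "?x v \<le> ?x (fst b)" if "v \<in> fst ` V" for v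
    using between[OF that] lt by fastforce+
  have "orient e c > 0 \<and> arc_dist b c < arc_dist e c" if e: "e \<in> V" "e \<noteq> b" for e
  proof -
    have ev: "fst e \<in> fst ` V" "snd e \<in> fst ` V" using e fst_snd_V by auto
    have ends: "\<not> (fst e = fst b \<and> snd e = snd b)" "\<not> (fst e = snd b \<and> snd e = fst b)"
      using e side_reverse[OF b(1)] by (cases e; cases b; auto)+
    \<comment> \<open>The ends of \<open>e\<close> lie in the interval spanned by \<open>b\<close>,
      and only \<open>b\<close> and its reverse join both extreme vertices.\<close>
    have less: "\<bar>?x (snd e) - ?x (fst e)\<bar> < \<bar>?x (snd b) - ?x (fst b)\<bar>"
      using range[OF ev(1)] range[OF ev(2)] between[OF ev(1)] between[OF ev(2)] lt ends side_distinct[OF e(1)]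
      by (cases "fst e = fst b"; cases "fst e = snd b"; cases "snd e = fst b"; cases "snd e = snd b") auto
    \<comment> \<open>A second side with \<open>c\<close> on its right would also span all vertices
      and thus have the same ends as \<open>b\<close>.\<close>
    have "\<not> orient e c < 0"
    proof
      assume "orient e c < 0"
      then have elt: "?x (snd e) < ?x (fst e)" using orient_coord_at(2)[OF nc[OF e(1)]] by simp
      have btw: "?x (snd e) < ?x v \<and> ?x v < ?x (fst e)"
        if "v \<in> fst ` V" "v \<noteq> fst e" "v \<noteq> snd e" for v
      proof -
        have "v \<noteq> c" using that assms by auto
        have "orient (fst e, snd e) v > 0" using vertex_left[OF e(1) that] by simp
        then have "(?x (snd e) - ?x (fst e)) * (?x v - ?x (snd e)) * (?x (fst e) - ?x v) < 0"
          using orient_coord_at3(1)[OF nc[OF e(1)] \<open>v \<noteq> c\<close>] by simp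
        then show ?thesis using elt by (auto simp: mult_less_0_iff zero_less_mult_iff)
      qed
      have bv: "fst b \<in> fst ` V" "snd b \<in> fst ` V" using b(1) fst_snd_V by auto
      show False
        using btw[OF bv(1)] btw[OF bv(2)] range[OF ev(1)] range[OF ev(2)] ends lt elt by force
    qed
    moreover have "orient e c \<noteq> 0" using nc e orient_eq_0_iff[OF side_distinct] by metis
    ultimately show ?thesis
      using arc_dist_less[OF nc[OF e(1)] nc[OF b(1)] side_distinct[OF e(1)] less] by simp
  qed
  then show ?thesis using that b(1) neg by blast
qed

section \<open>Action of the gluings on the sides\<close>

lemma glue_carrier: "a \<in> V \<Longrightarrow> glue a \<in> carrier PSL2Z"
  using gluing_integral by (auto simp: gluing_class_def carrier_PSL2Z)

lemma det_gluing: "a \<in> V \<Longrightarrow> det (gluing star mu a) = 1"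
  using gluing_integral by (auto simp: SL2Z_def)

lemma glue_act: "psl_act (glue a) c = moebius (gluing star mu a) c"
  by (simp add: gluing_class_def psl_act_class)

lemma gluing_order2:
  assumes "a \<in> V" "\<not> order3 a"
  shows "gluing star mu a = arc_matrix a ** matrix_inv (arc_matrix_neg (star a))"
  using assms mu_range[of a] by (auto simp: gluing_def order3_def elliptic_arcs_def)

lemma order3_star: "a \<in> V \<Longrightarrow> \<not> order3 a \<Longrightarrow> \<not> order3 (star a)"
  using star_star by (auto simp: order3_def)

text \<open>Left multiplication by the gluing takes \<open>arc_matrix_neg (star a)\<close> to
  \<open>arc_matrix a\<close>, which gives the action on the ends. In the product of the two gluings
  the middle factors cancel to the square of \<open>?S\<close>, which is minus the identity: the
  relation holds in PSL2 and not in SL2.\<close>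

lemma glue_order2:
  assumes a: "a \<in> V" "\<not> order3 a"
  shows "psl_act (glue a) (fst (star a)) = snd a" "psl_act (glue a) (snd (star a)) = fst a"
    "glue a \<otimes>\<^bsub>PSL2Z\<^esub> glue (star a) = \<one>\<^bsub>PSL2Z\<^esub>"
proof -
  let ?g = "gluing star mu a" and ?A = "arc_matrix a" and ?B = "arc_matrix (star a)"
  let ?A' = "arc_matrix_neg a" and ?B' = "arc_matrix_neg (star a)" and ?S = "mat22 0 1 (- 1) 0"
  have sa: "star a \<in> V" using a star_closed by blast
  note A = arc_matrix_props[OF side_distinct[OF a(1)]]
  note B = arc_matrix_props[OF side_distinct[OF sa]]
  have dA: "det ?A \<noteq> 0" "det ?A' \<noteq> 0" and dB: "det ?B \<noteq> 0" "det ?B' \<noteq> 0" using A B by simp_all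
  have "?g ** ?B' = ?A ** (matrix_inv ?B' ** ?B')"
    unfolding gluing_order2[OF a] matrix_mul_assoc ..
  then have gB: "?g ** ?B' = ?A" using matrix_inv_mult(2)[OF dB(2)] by simp
  have "moebius ?g (moebius ?B' c) = moebius ?A c" for c
    using moebius_mult[of ?g ?B' c] gB dB det_gluing[OF a(1)] by simp
  then show "psl_act (glue a) (fst (star a)) = snd a" "psl_act (glue a) (snd (star a)) = fst a"
    unfolding glue_act using A(2,3) B(5,6) by metis+
  have star: "gluing star mu (star a) = ?B ** matrix_inv ?A'"
    using gluing_order2[OF sa order3_star[OF a]] star_star[OF a(1)] by simp
  have "?g ** gluing star mu (star a) = ?A' ** ?S ** (matrix_inv ?B' ** ?B') ** ?S ** matrix_inv ?A'"
    unfolding gluing_order2[OF a] star matrix_mul_assoc by (metis A(8) B(8) matrix_mul_assoc)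
  also have "\<dots> = ?A' ** (?S ** ?S) ** matrix_inv ?A'"
    unfolding matrix_inv_mult(2)[OF dB(2)] by (simp add: matrix_mul_assoc)
  also have "?S ** ?S = - mat 1" by (simp add: mat2_eq_iff mat2_mult_nth mat_def)
  also have "?A' ** - mat 1 ** matrix_inv ?A' = - (?A' ** matrix_inv ?A')"
    by (simp add: mat2_eq_iff mat2_mult_nth mat_def)
  also have "\<dots> = - mat 1" using matrix_inv_mult(1)[OF dA(2)] by simp
  finally have "psl_class (?g ** gluing star mu (star a)) = psl_class (mat 1)"
    by (auto simp: psl_class_eq)
  then show "glue a \<otimes>\<^bsub>PSL2Z\<^esub> glue (star a) = \<one>\<^bsub>PSL2Z\<^esub>"
    using psl_class_mult[OF gluing_integral[OF a(1)] gluing_integral[OF sa]]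
    by (simp add: gluing_class_def) (simp add: PSL2Z_def psl_class_eq)
qed

text \<open>The matrix \<open>?U\<close> of order 3 moves infinity to 0, 0 to 1 and 1 to infinity,
  and \<open>arc_matrix_neg a\<close> carries these three cusps to \<open>snd a\<close>,
  \<open>fst a\<close> and \<open>t\<close>. Since \<open>t\<close> is also the image of -1 under
  \<open>arc_matrix a\<close>, it lies on the right of \<open>a\<close>.\<close>

lemma glue_order3:
  assumes a: "a \<in> V" "order3 a"
  defines "t \<equiv> psl_act (glue a) (fst a)"
  shows "psl_act (glue a) (snd a) = fst a" "psl_act (glue a) t = snd a" "orient a t < 0"
    "glue a \<otimes>\<^bsub>PSL2Z\<^esub> glue a \<otimes>\<^bsub>PSL2Z\<^esub> glue a = \<one>\<^bsub>PSL2Z\<^esub>"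
proof -
  let ?g = "gluing star mu a" and ?N = "arc_matrix_neg a" and ?U = "mat22 0 (- 1) 1 (- 1)"
  note A = arc_matrix_props[OF side_distinct[OF a(1)]]
  have dN: "det ?N \<noteq> 0" using A by simp
  have g: "?g = ?N ** ?U ** matrix_inv ?N" using a(2) by (simp add: gluing_def order3_def)
  have "?g ** ?N = ?N ** ?U ** (matrix_inv ?N ** ?N)"
    unfolding g matrix_mul_assoc ..
  then have gN: "?g ** ?N = ?N ** ?U" using matrix_inv_mult(2)[OF dN] by simp
  have act: "moebius ?g (moebius ?N c) = moebius ?N (moebius ?U c)" for c
    using moebius_mult[of ?g ?N c] moebius_mult[of ?N ?U c] gN dN det_gluing[OF a(1)]
    by (simp add: det_mat22)
  have t: "t = moebius ?N (Fin 1)"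
    unfolding t_def glue_act using act[of "Fin 0"] A(6) by simp
  show "psl_act (glue a) (snd a) = fst a" "psl_act (glue a) t = snd a"
    unfolding glue_act t using act[of Infty] act[of "Fin 1"] A(5,6) by simp_all
  have "of_int (sgn (orient a t)) = (sgn (- 1) :: rat)"
    using orient_arc_matrix[OF side_distinct[OF a(1)], of "-1"] t A(7) by simp
  then have "sgn (orient a t) = - 1" by simp
  then show "orient a t < 0" by (simp add: sgn_if split: if_splits)
  have "?g ** ?g ** ?g = ?N ** ?U ** (matrix_inv ?N ** ?N) ** ?U ** (matrix_inv ?N ** ?N) ** ?U ** matrix_inv ?N"
    unfolding g matrix_mul_assoc ..
  also have "\<dots> = ?N ** (?U ** ?U ** ?U) ** matrix_inv ?N"
    unfolding matrix_inv_mult(2)[OF dN] by (simp add: matrix_mul_assoc)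
  also have "?U ** ?U ** ?U = mat 1" by (simp add: mat2_eq_iff mat2_mult_nth mat_def)
  also have "?N ** mat 1 ** matrix_inv ?N = mat 1" using matrix_inv_mult(1)[OF dN] by simp
  finally have "?g ** ?g ** ?g = mat 1" .
  moreover have "?g ** ?g \<in> carrier SL2Z"
    using group.is_monoid[OF group_SL2Z] monoid.m_closed[of SL2Z ?g ?g] gluing_integral[OF a(1)]
    by (simp add: SL2Z_def)
  ultimately show "glue a \<otimes>\<^bsub>PSL2Z\<^esub> glue a \<otimes>\<^bsub>PSL2Z\<^esub> glue a = \<one>\<^bsub>PSL2Z\<^esub>"
    using gluing_integral[OF a(1)] by (simp add: gluing_class_def psl_class_mult) (simp add: PSL2Z_def psl_class_eq)
qed

end

section \<open>Descent of cusps to the vertices\<close>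

context extended_farey_symbol
begin

lemma side_least:
  assumes "c \<notin> fst ` V" "b \<in> V" "orient b c < 0" "e \<in> V" "e \<noteq> b"
  shows "orient e c > 0" "arc_dist b c < arc_dist e c"
proof -
  obtain b' where b': "b' \<in> V" "orient b' c < 0"
    "\<And>e. e \<in> V \<Longrightarrow> e \<noteq> b' \<Longrightarrow> orient e c > 0 \<and> arc_dist b' c < arc_dist e c"
    using side_of[OF assms(1)] by blast
  have "b' = b" using b'(3)[OF assms(2)] assms(3) by (metis order_less_asym)
  then show "orient e c > 0" "arc_dist b c < arc_dist e c" using b'(3) assms by blast+
qed

lemma not_vertex: "b \<in> V \<Longrightarrow> orient b c < 0 \<Longrightarrow> c \<notin> fst ` V"
  using vertex_left[of b c] orient_eq_0_iff[OF side_distinct, of b c]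
  by (metis order_less_asym order_less_irrefl)

definition det_prod :: int where
  "det_prod = (\<Prod>e\<in>V. \<bar>cusp_det (fst e) (snd e)\<bar>)"

text \<open>The factor \<open>det_prod\<close> clears the denominators of \<open>arc_dist\<close>.\<close>

definition height :: "cusp \<Rightarrow> nat" where
  "height c = nat \<lfloor>Min ((\<lambda>e. of_int det_prod * arc_dist e c) ` V)\<rfloor>"

lemma det_prod_pos: "det_prod > 0"
  unfolding det_prod_def using side_distinct by (intro prod_pos) (auto simp: cusp_det_eq_0_iff)

lemma det_prod_arc_dist_Ints:
  assumes "e \<in> V"
  shows "of_int det_prod * arc_dist e c \<in> \<int>"
proof -
  let ?d = "\<bar>cusp_det (fst e) (snd e)\<bar>"
  have "?d \<noteq> 0" using side_distinct[OF assms] by (simp add: cusp_det_eq_0_iff)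
  have "?d dvd det_prod" unfolding det_prod_def using finite_V assms by (intro dvd_prodI) auto
  then obtain k where "det_prod = ?d * k" ..
  then have "of_int det_prod * arc_dist e c = of_int (k * \<bar>cusp_det (fst e) c * cusp_det (snd e) c\<bar>)"
    using \<open>?d \<noteq> 0\<close> by (simp add: arc_dist_def)
  then show ?thesis by (simp only: Ints_of_int)
qed

text \<open>By \<open>side_least\<close> the minimum defining \<open>height c\<close> is attained at
  \<open>b\<close>, so one side \<open>e\<close> that is closer to \<open>d\<close> suffices. The
  inequality stays strict under the floor because the scaled distance at \<open>b\<close> is an
  integer.\<close>

lemma height_less:
  assumes "b \<in> V" "orient b c < 0" "e \<in> V" "arc_dist e d < arc_dist b c"
  shows "height d < height c"
proof -
  let ?f = "\<lambda>c e. of_int det_prod * arc_dist e c"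
  have L: "(of_int det_prod :: rat) > 0" using det_prod_pos by simp
  have fin: "finite (?f c ` V)" "?f c ` V \<noteq> {}" for c using finite_V assms by auto
  have c: "Min (?f c ` V) = ?f c b"
  proof (rule Min_eqI)
    fix y assume "y \<in> ?f c ` V"
    then obtain e where e: "e \<in> V" "y = ?f c e" by auto
    have "arc_dist b c \<le> arc_dist e c"
      using side_least(2)[OF not_vertex[OF assms(1,2)] assms(1,2) e(1)] by (cases "e = b") auto
    then show "?f c b \<le> y" using L e by simp
  qed (use fin assms in auto)
  have "Min (?f d ` V) \<le> ?f d e" using fin assms by (intro Min_le) auto
  also have "\<dots> < ?f c b" using L assms by simp
  finally have "Min (?f d ` V) < ?f c b" .
  moreover obtain n where n: "?f c b = of_int n" using det_prod_arc_dist_Ints[OF assms(1)] by (meson Ints_cases)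
  moreover have "Min (?f d ` V) \<ge> 0"
    using L Min_in[OF fin[of d]] by (auto simp: arc_dist_nonneg)
  ultimately show ?thesis unfolding height_def c by (simp add: n floor_less_iff)
qed

abbreviation apex :: "arc \<Rightarrow> cusp" where
  "apex a \<equiv> psl_act (glue a) (fst a)"

definition crossed_side :: "cusp \<Rightarrow> arc" where
  "crossed_side c = (SOME b. b \<in> V \<and> orient b c < 0)"

text \<open>The element of \<open>\<Gamma>\<close> taking the polygon to the next one on the way to \<open>c\<close>. Behind a side of order 3
  lies the triangle with third vertex \<open>apex\<close>, so there are two candidates.\<close>

definition crossing :: "cusp \<Rightarrow> mat2 set" where
  "crossing c = (let b = crossed_side c in
     if order3 b \<and> orient (apex b, fst b) c < 0 then glue b \<otimes>\<^bsub>PSL2Z\<^esub> glue b else glue b)"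

lemma crossed_side_eq:
  assumes "b \<in> V" "orient b c < 0"
  shows "crossed_side c = b"
proof -
  have "crossed_side c \<in> V \<and> orient (crossed_side c) c < 0"
    unfolding crossed_side_def using someI[of "\<lambda>b. b \<in> V \<and> orient b c < 0" b] assms by blast
  then show ?thesis using side_least(1)[OF not_vertex[OF assms] assms, of "crossed_side c"]
    by (metis order_less_asym)
qed

lemma crossed_side:
  assumes "c \<notin> fst ` V"
  shows "crossed_side c \<in> V" "orient (crossed_side c) c < 0"
proof -
  obtain b where "b \<in> V" "orient b c < 0" using side_of[OF assms] by blast
  then show "crossed_side c \<in> V" "orient (crossed_side c) c < 0"
    using crossed_side_eq[of b c] by auto
qed

lemma glue_arc_dist:
  assumes "g \<in> carrier PSL2Z" "psl_act g r = r'" "psl_act g s = s'"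
  shows "arc_dist (r, s) (psl_act (inv\<^bsub>PSL2Z\<^esub> g) c) = arc_dist (r', s') c"
    and "sgn (orient (r, s) (psl_act (inv\<^bsub>PSL2Z\<^esub> g) c)) = sgn (orient (r', s') c)"
  using psl_act_arc_dist[OF assms(1), of r s "psl_act (inv\<^bsub>PSL2Z\<^esub> g) c"]
    psl_act_orient[OF assms(1), of r s "psl_act (inv\<^bsub>PSL2Z\<^esub> g) c"] assms
  by (simp_all add: psl_act_inv)

lemma height_crossing:
  assumes c: "c \<notin> fst ` V"
  shows "height (psl_act (inv\<^bsub>PSL2Z\<^esub> (crossing c)) c) < height c"
proof -
  define b where "b = crossed_side c"
  define d where "d = psl_act (inv\<^bsub>PSL2Z\<^esub> (crossing c)) c"
  have b: "b \<in> V" "orient b c < 0" using crossed_side[OF c] by (simp_all add: b_def)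
  have g: "glue b \<in> carrier PSL2Z" using glue_carrier[OF b(1)] .
  have "orient b c \<noteq> 0" using b by simp
  then have "c \<noteq> fst b" "c \<noteq> snd b" using orient_eq_0_iff[OF side_distinct[OF b(1)], of c] by simp_all
  have pos: "arc_dist b c > 0"
    using arc_dist_nonneg[of b c] arc_dist_eq_0_iff[OF side_distinct[OF b(1)], of c] \<open>c \<noteq> fst b\<close> \<open>c \<noteq> snd b\<close> by linarith
  \<comment> \<open>At a vertex some side has distance 0, whereas \<open>c\<close> is not an end of
    \<open>b\<close>.\<close>
  have vert: "height d < height c" if vd: "d \<in> fst ` V"
  proof -
    obtain e where "e \<in> V" "d = fst e" using vd by blast
    then have "arc_dist e d < arc_dist b c"
      using pos arc_dist_eq_0_iff[OF side_distinct[of e], of d] by simp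
    then show ?thesis using height_less b \<open>e \<in> V\<close> by blast
  qed
  show ?thesis unfolding d_def[symmetric]
  proof (cases "order3 b")
    case False
    have sb: "star b \<in> V" using b star_closed by blast
    have d: "d = psl_act (inv\<^bsub>PSL2Z\<^esub> (glue b)) c" using False by (simp add: d_def crossing_def b_def Let_def)
    note gl = glue_arc_dist[OF g glue_order2(1)[OF b(1) False] glue_order2(2)[OF b(1) False], of c]
    \<comment> \<open>After the crossing \<open>star b\<close> is as far from \<open>d\<close> as
      \<open>b\<close> was from \<open>c\<close>, but \<open>d\<close> is on its left. Hence the
      side separating \<open>d\<close> from the polygon is a different one, and strictly
      closer.\<close>
    have dist: "arc_dist (star b) d = arc_dist b c"
      using gl(1) arc_dist_swap[of b c] by (simp add: d prod.swap_def)
    have "orient (prod.swap b) c > 0" using b(2) by (simp add: orient_swap)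
    then have pos': "orient (star b) d > 0"
      using gl(2) by (simp add: d prod.swap_def sgn_if split: if_splits)
    show "height d < height c"
    proof (cases "d \<in> fst ` V")
      case False
      note e = crossed_side[OF False]
      have "star b \<noteq> crossed_side d" using e pos' by auto
      then show ?thesis using side_least(2)[OF False e sb] dist height_less[OF b e(1)] by simp
    qed (rule vert)
  next
    case True
    \<comment> \<open>Here \<open>b\<close> itself gets closer: \<open>c\<close> lies beyond one of
      the other two sides of the triangle, which is closer to \<open>c\<close> than
      \<open>b\<close>, and the crossing carries \<open>b\<close> onto that side. The apex goes to
      the vertex \<open>fst b\<close>.\<close>
    have t: "orient (fst b, snd b) (apex b) < 0" using glue_order3(3)[OF b(1) True] by simp
    note act = glue_order3(1,2)[OF b(1) True]
    show "height d < height c"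
    proof (cases "orient (apex b, fst b) c < 0")
      case neg: True
      have d: "d = psl_act (inv\<^bsub>PSL2Z\<^esub> (glue b \<otimes>\<^bsub>PSL2Z\<^esub> glue b)) c"
        using True neg by (simp add: d_def crossing_def b_def Let_def)
      have "c \<noteq> apex b" using neg by (auto simp: orient_def)
      then have "arc_dist (snd b, apex b) c < arc_dist b c"
        using triangle_orient[OF t, of c] neg b \<open>c \<noteq> fst b\<close> \<open>c \<noteq> snd b\<close> by auto
      moreover have "arc_dist b d = arc_dist (snd b, apex b) c"
        using glue_arc_dist(1)[of "glue b \<otimes>\<^bsub>PSL2Z\<^esub> glue b" "fst b" "snd b" "snd b" "apex b" c] g act
        by (simp add: d psl_act_mult monoid.m_closed[OF group.is_monoid[OF group_PSL2Z]])
      ultimately show ?thesis using height_less[OF b b(1)] by simp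
    next
      case nonneg: False
      have d: "d = psl_act (inv\<^bsub>PSL2Z\<^esub> (glue b)) c"
        using nonneg by (simp add: d_def crossing_def b_def Let_def)
      show ?thesis
      proof (cases "c = apex b")
        case True
        then have "d = fst b" using g by (simp add: d psl_act_inv)
        then show ?thesis using vert b by simp
      next
        case False
        then have "arc_dist (apex b, fst b) c < arc_dist b c"
          using triangle_orient[OF t, of c] nonneg b \<open>c \<noteq> fst b\<close> \<open>c \<noteq> snd b\<close> by auto
        moreover have "arc_dist b d = arc_dist (apex b, fst b) c"
          using glue_arc_dist(1)[OF g refl act(1), of "fst b" c] by (simp add: d)
        ultimately show ?thesis using height_less[OF b b(1)] by simp
      qed
    qed
  qed
qed

end

section \<open>Chains of symbols and the potential\<close>

type_synonym symbol_chain = "(mat2 set \<times> arc) \<Rightarrow>\<^sub>0 int"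

definition translate :: "mat2 set \<Rightarrow> symbol_chain \<Rightarrow> symbol_chain" where
  "translate g = frag_extend (\<lambda>(h, a). frag_of (g \<otimes>\<^bsub>PSL2Z\<^esub> h, a))"

text \<open>The group laws of \<open>PSL2Z\<close> hold only on its carrier, so
  \<open>translate\<close> is an action only on these chains.\<close>

definition psl_chains :: "symbol_chain set" where
  "psl_chains = {x. Poly_Mapping.keys x \<subseteq> carrier PSL2Z \<times> UNIV}"

lemma translate_0 [simp]: "translate g 0 = 0"
  and translate_add: "translate g (x + y) = translate g x + translate g y"
  and translate_diff: "translate g (x - y) = translate g x - translate g y"
  and translate_minus: "translate g (- x) = - translate g x"
  and translate_of [simp]: "translate g (frag_of (h, a)) = frag_of (g \<otimes>\<^bsub>PSL2Z\<^esub> h, a)"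
  by (simp_all add: translate_def frag_extend_add frag_extend_diff frag_extend_minus)

lemma translate_sum: "translate g (sum f A) = (\<Sum>a\<in>A. translate g (f a))"
  by (induction A rule: infinite_finite_induct) (simp_all add: translate_add)

lemma translate_one: "x \<in> psl_chains \<Longrightarrow> translate \<one>\<^bsub>PSL2Z\<^esub> x = x"
proof -
  interpret group PSL2Z by (rule group_PSL2Z)
  assume "x \<in> psl_chains"
  then have "Poly_Mapping.keys x \<subseteq> carrier PSL2Z \<times> UNIV" by (simp add: psl_chains_def)
  then show ?thesis by (induction x rule: frag_induction) (auto simp: translate_diff)
qed

lemma translate_translate:
  assumes "g \<in> carrier PSL2Z" "h \<in> carrier PSL2Z" "x \<in> psl_chains"
  shows "translate g (translate h x) = translate (g \<otimes>\<^bsub>PSL2Z\<^esub> h) x"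
proof -
  interpret group PSL2Z by (rule group_PSL2Z)
  have "Poly_Mapping.keys x \<subseteq> carrier PSL2Z \<times> UNIV" using assms by (simp add: psl_chains_def)
  then show ?thesis using assms(1,2)
    by (induction x rule: frag_induction) (auto simp: translate_diff m_assoc)
qed

lemma psl_chains_0: "0 \<in> psl_chains"
  and psl_chains_of: "g \<in> carrier PSL2Z \<Longrightarrow> frag_of (g, a) \<in> psl_chains"
  by (simp_all add: psl_chains_def)

lemma psl_chains_minus: "x \<in> psl_chains \<Longrightarrow> - x \<in> psl_chains"
  by (simp add: psl_chains_def)

lemma psl_chains_diff: "x \<in> psl_chains \<Longrightarrow> y \<in> psl_chains \<Longrightarrow> x - y \<in> psl_chains"
  using keys_diff[of x y] unfolding psl_chains_def by blast

lemma psl_chains_add: "x \<in> psl_chains \<Longrightarrow> y \<in> psl_chains \<Longrightarrow> x + y \<in> psl_chains"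
  using keys_add[of x y] unfolding psl_chains_def by blast

lemma psl_chains_sum: "(\<And>a. a \<in> A \<Longrightarrow> f a \<in> psl_chains) \<Longrightarrow> sum f A \<in> psl_chains"
  by (induction A rule: infinite_finite_induct) (simp_all add: psl_chains_0 psl_chains_add)

lemma psl_chains_translate:
  assumes "g \<in> carrier PSL2Z" "x \<in> psl_chains"
  shows "translate g x \<in> psl_chains"
proof -
  interpret group PSL2Z by (rule group_PSL2Z)
  have "Poly_Mapping.keys x \<subseteq> carrier PSL2Z \<times> UNIV" using assms by (simp add: psl_chains_def)
  then show ?thesis using assms(1)
    by (induction x rule: frag_induction) (auto simp: psl_chains_0 translate_diff psl_chains_diff psl_chains_of)
qed

text \<open>Applied with the vertices as \<open>B\<close> and the descent as \<open>red\<close>. The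
  restriction that \<open>wfrec\<close> puts on recursive calls is invisible because
  \<open>red c\<close> has smaller measure.\<close>

lemma measure_recursion:
  fixes m :: "'a \<Rightarrow> nat"
  assumes "\<And>c. c \<notin> B \<Longrightarrow> m (red c) < m c"
  obtains f where "\<And>c. c \<in> B \<Longrightarrow> f c = f0 c" "\<And>c. c \<notin> B \<Longrightarrow> f c = step c (f (red c))"
proof -
  define H where "H f c = (if c \<in> B then f0 c else step c (f (red c)))" for f c
  have "wfrec (Wellfounded.measure m) H c = H (wfrec (Wellfounded.measure m) H) c" for c
    using assms by (subst wfrec[OF wf_measure]) (simp add: H_def cut_def)
  then show ?thesis by (intro that[of "wfrec (Wellfounded.measure m) H"]) (simp_all add: H_def)
qed

context extended_farey_symbol
begin

abbreviation \<Gamma> :: "mat2 set set" where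
  "\<Gamma> \<equiv> generate PSL2Z (glue ` V)"

lemma subgroup_\<Gamma>: "subgroup \<Gamma> PSL2Z"
  using glue_carrier group.generate_is_subgroup[OF group_PSL2Z] by blast

lemma glue_\<Gamma>: "a \<in> V \<Longrightarrow> glue a \<in> \<Gamma>"
  by (auto intro: generate.incl)

lemma \<Gamma>_carrier: "g \<in> \<Gamma> \<Longrightarrow> g \<in> carrier PSL2Z"
  using subgroup.mem_carrier[OF subgroup_\<Gamma>] .

lemma \<Gamma>_mult: "g \<in> \<Gamma> \<Longrightarrow> h \<in> \<Gamma> \<Longrightarrow> g \<otimes>\<^bsub>PSL2Z\<^esub> h \<in> \<Gamma>"
  using subgroup.m_closed[OF subgroup_\<Gamma>] .

lemma \<Gamma>_one: "\<one>\<^bsub>PSL2Z\<^esub> \<in> \<Gamma>"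
  using subgroup.one_closed[OF subgroup_\<Gamma>] .

lemma \<Gamma>_inv: "g \<in> \<Gamma> \<Longrightarrow> inv\<^bsub>PSL2Z\<^esub> g \<in> \<Gamma>"
  using subgroup.m_inv_closed[OF subgroup_\<Gamma>] .

lemma glue_star:
  assumes "a \<in> V" "\<not> order3 a"
  shows "glue (star a) = inv\<^bsub>PSL2Z\<^esub> (glue a)"
proof -
  interpret group PSL2Z by (rule group_PSL2Z)
  show ?thesis using glue_order2(3)[OF assms] glue_carrier assms star_closed inv_equality inv_comm
    by metis
qed

end

text \<open>\<open>N\<close> plays the part of the relation submodule: closure under differences and
  translates encodes stability under the group ring. It is kept abstract and later instantiated with
  the image of the submodule generated by the Farey relations.\<close>

locale farey_chains = extended_farey_symbol +
  fixes E :: "arc set" and N :: "symbol_chain set"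
  assumes reps: "representatives V star E"
    and N_zero: "0 \<in> N"
    and N_diff: "x \<in> N \<Longrightarrow> y \<in> N \<Longrightarrow> x - y \<in> N"
    and N_translate: "g \<in> \<Gamma> \<Longrightarrow> x \<in> N \<Longrightarrow> translate g x \<in> N"
    and N_boundary: "(\<Sum>a\<in>E. frag_of (\<one>\<^bsub>PSL2Z\<^esub>, a) - frag_of (inv\<^bsub>PSL2Z\<^esub> (glue a), a)) +
      (\<Sum>a\<in>elliptic_arcs V star. frag_of (\<one>\<^bsub>PSL2Z\<^esub>, a)) \<in> N"
    and N_elliptic: "a \<in> elliptic_arcs V star \<Longrightarrow> (\<Sum>s<mu a. frag_of (glue a [^]\<^bsub>PSL2Z\<^esub> s, a)) \<in> N"
begin

lemma N_minus: "x \<in> N \<Longrightarrow> - x \<in> N"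
  using N_diff[OF N_zero, of x] by simp

lemma N_add: "x \<in> N \<Longrightarrow> y \<in> N \<Longrightarrow> x + y \<in> N"
  using N_diff[OF _ N_minus, of x y] by simp

text \<open>The class of \<open>g a\<close> for every side \<open>a\<close>; outside of \<open>E\<close> it is \<open>g a = - g \<gamma>\<^sub>a a\<^sup>*\<close>.\<close>

definition symb :: "mat2 set \<Rightarrow> arc \<Rightarrow> symbol_chain" where
  "symb g a = (if a \<in> E \<union> elliptic_arcs V star then frag_of (g, a)
     else - frag_of (g \<otimes>\<^bsub>PSL2Z\<^esub> glue a, star a))"

lemma E_props:
  assumes "a \<in> E"
  shows "a \<in> V" "star a \<noteq> a" "star a \<in> V" "star a \<notin> E" "star (star a) = a" "\<not> order3 a" "a \<notin> elliptic_arcs V star" "star a \<notin> elliptic_arcs V star"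
proof -
  have "a \<in> V - elliptic_arcs V star" using reps assms by (auto simp: representatives_def)
  then show a: "a \<in> V" "star a \<noteq> a" "a \<notin> elliptic_arcs V star" by (auto simp: elliptic_arcs_def)
  then show "star a \<in> V" "star (star a) = a" using star_closed star_star by auto
  then show "star a \<notin> elliptic_arcs V star" using a by (auto simp: elliptic_arcs_def)
  show "\<not> order3 a" using a by (simp add: order3_def)
  have "\<exists>!e. e \<in> E \<and> (e = a \<or> e = star a)" using reps a by (auto simp: representatives_def)
  then show "star a \<notin> E" using assms a(2) by metis
qed

lemma star_in_E: "a \<in> V \<Longrightarrow> a \<notin> E \<Longrightarrow> a \<notin> elliptic_arcs V star \<Longrightarrow> star a \<in> E"
  using reps by (auto simp: representatives_def)

lemma symb_chains: "g \<in> carrier PSL2Z \<Longrightarrow> a \<in> V \<Longrightarrow> symb g a \<in> psl_chains"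
  using monoid.m_closed[OF group.is_monoid[OF group_PSL2Z]] glue_carrier
  by (auto simp: symb_def psl_chains_of psl_chains_minus)

lemma translate_symb:
  assumes "g \<in> carrier PSL2Z" "h \<in> carrier PSL2Z" "a \<in> V"
  shows "translate g (symb h a) = symb (g \<otimes>\<^bsub>PSL2Z\<^esub> h) a"
proof -
  interpret group PSL2Z by (rule group_PSL2Z)
  show ?thesis using assms glue_carrier by (auto simp: symb_def translate_minus m_assoc)
qed

text \<open>For paired sides this is the convention behind \<open>symb\<close>, and the sum is zero;
  for an elliptic side of order 2 it is the elliptic relation.\<close>

lemma symb_star:
  assumes a: "a \<in> V" "\<not> order3 a"
  shows "symb \<one>\<^bsub>PSL2Z\<^esub> a + symb (glue a) (star a) \<in> N"
proof -
  interpret group PSL2Z by (rule group_PSL2Z)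
  have g: "glue a \<in> carrier PSL2Z" "glue (star a) \<in> carrier PSL2Z"
    using a star_closed glue_carrier by auto
  consider "a \<in> elliptic_arcs V star" | "a \<in> E" | "a \<notin> elliptic_arcs V star" "a \<notin> E" by blast
  then show ?thesis
  proof cases
    case 1
    then have "star a = a" "mu a = 2" using a mu_range[OF 1] by (auto simp: elliptic_arcs_def order3_def)
    then show ?thesis using N_elliptic[OF 1] 1 g by (simp add: symb_def numeral_2_eq_2)
  next
    case 2
    then show ?thesis using E_props[OF 2] glue_order2(3)[OF a] N_zero by (simp add: symb_def)
  next
    case 3
    then show ?thesis using star_in_E[OF a(1)] N_zero g by (simp add: symb_def)
  qed
qed

text \<open>The origin of the coefficient \<open>farey_lambda\<close>: the partner
  \<open>star a\<close> of a representative contributes minus the symbol of \<open>a\<close>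
  translated by \<open>glue (star a)\<close>, which is the inverse of \<open>glue a\<close>.\<close>

lemma symb_boundary: "(\<Sum>a\<in>V. symb \<one>\<^bsub>PSL2Z\<^esub> a) =
  (\<Sum>a\<in>E. frag_of (\<one>\<^bsub>PSL2Z\<^esub>, a) - frag_of (inv\<^bsub>PSL2Z\<^esub> (glue a), a)) +
      (\<Sum>a\<in>elliptic_arcs V star. frag_of (\<one>\<^bsub>PSL2Z\<^esub>, a))"
proof -
  interpret group PSL2Z by (rule group_PSL2Z)
  let ?S = "symb \<one>\<^bsub>PSL2Z\<^esub>" and ?L = "elliptic_arcs V star"
  have V: "V = (E \<union> star ` E) \<union> ?L"
  proof
    show "V \<subseteq> (E \<union> star ` E) \<union> ?L"
    proof
      fix a assume "a \<in> V"
      then show "a \<in> (E \<union> star ` E) \<union> ?L" using star_in_E[of a] star_star[of a]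
        by (metis UnCI imageI)
    qed
    show "(E \<union> star ` E) \<union> ?L \<subseteq> V" using E_props by (auto simp: elliptic_arcs_def)
  qed
  have fin: "finite E" "finite ?L" using finite_V V by (metis finite_Un)+
  have inj: "inj_on star E" by (metis E_props(5) inj_onI)
  have "(\<Sum>a\<in>V. ?S a) = (\<Sum>a\<in>E \<union> star ` E. ?S a) + (\<Sum>a\<in>?L. ?S a)"
    using fin E_props by (subst V, subst sum.union_disjoint) auto
  also have "(\<Sum>a\<in>E \<union> star ` E. ?S a) = (\<Sum>a\<in>E. ?S a) + (\<Sum>a\<in>star ` E. ?S a)"
    using fin E_props(4) by (subst sum.union_disjoint) auto
  also have "(\<Sum>a\<in>star ` E. ?S a) = (\<Sum>a\<in>E. ?S (star a))"
    using inj by (simp add: sum.reindex)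
  also have "(\<Sum>a\<in>E. ?S a) + (\<Sum>a\<in>E. ?S (star a)) =
      (\<Sum>a\<in>E. frag_of (\<one>\<^bsub>PSL2Z\<^esub>, a) - frag_of (inv\<^bsub>PSL2Z\<^esub> (glue a), a))"
    unfolding sum.distrib[symmetric]
  proof (rule sum.cong)
    fix a assume a: "a \<in> E"
    note E = E_props[OF a]
    show "?S a + ?S (star a) = frag_of (\<one>\<^bsub>PSL2Z\<^esub>, a) - frag_of (inv\<^bsub>PSL2Z\<^esub> (glue a), a)"
      using a E glue_star[of a] glue_carrier[of a] by (simp add: symb_def)
  qed simp
  also have "(\<Sum>a\<in>?L. ?S a) = (\<Sum>a\<in>?L. frag_of (\<one>\<^bsub>PSL2Z\<^esub>, a))"
    by (rule sum.cong) (auto simp: symb_def)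
  finally show ?thesis .
qed

end

text \<open>\<open>\<kappa> a\<close> is forced, since \<open>glue a\<close> takes
  \<open>snd (star a)\<close> to \<open>fst a\<close> for sides of every kind. The longer correction
  in the recursion is the value that the cocycle rule assigns to the square of
  \<open>glue b\<close>.\<close>

locale farey_cocycle = farey_chains +
  fixes p :: "cusp \<Rightarrow> symbol_chain" and \<psi> :: "cusp \<Rightarrow> symbol_chain" and \<kappa> :: "arc \<Rightarrow> symbol_chain"
  assumes p_chains: "p v \<in> psl_chains"
    and p_side: "a \<in> V \<Longrightarrow> p (snd a) - p (fst a) - symb \<one>\<^bsub>PSL2Z\<^esub> a \<in> N"
    and \<kappa>_eq: "\<kappa> a = p (fst a) - translate (glue a) (p (snd (star a)))"
    and \<psi>_vertex: "v \<in> fst ` V \<Longrightarrow> \<psi> v = p v"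
    and \<psi>_cross: "c \<notin> fst ` V \<Longrightarrow> \<psi> c = (let b = crossed_side c; g = crossing c in
      translate g (\<psi> (psl_act (inv\<^bsub>PSL2Z\<^esub> g) c)) +
      (if order3 b \<and> orient (apex b, fst b) c < 0 then \<kappa> b + translate (glue b) (\<kappa> b) else \<kappa> b))"
begin

lemma vertices: "a \<in> V \<Longrightarrow> fst a \<in> fst ` V" "a \<in> V \<Longrightarrow> snd a \<in> fst ` V"
  using fst_snd_V by auto

lemma \<kappa>_chains: "a \<in> V \<Longrightarrow> \<kappa> a \<in> psl_chains"
  unfolding \<kappa>_eq by (intro psl_chains_diff psl_chains_translate p_chains glue_carrier)

lemma \<psi>_chains: "\<psi> c \<in> psl_chains"
proof (induction "height c" arbitrary: c rule: less_induct)
  case less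
  interpret group PSL2Z by (rule group_PSL2Z)
  show ?case
  proof (cases "c \<in> fst ` V")
    case True
    then show ?thesis by (simp add: \<psi>_vertex p_chains)
  next
    case False
    have b: "crossed_side c \<in> V" using crossed_side[OF False] by simp
    have "\<psi> (psl_act (inv\<^bsub>PSL2Z\<^esub> (crossing c)) c) \<in> psl_chains"
      using less height_crossing[OF False] by blast
    moreover have "crossing c \<in> carrier PSL2Z" using glue_carrier[OF b] by (simp add: crossing_def Let_def)
    ultimately show ?thesis using \<kappa>_chains[OF b] glue_carrier[OF b]
      unfolding \<psi>_cross[OF False] Let_def by (auto intro!: psl_chains_add psl_chains_translate)
  qed
qed

text \<open>Strictly behind \<open>a\<close> this is the recursion. At \<open>fst a\<close> it is
  the definition of \<open>\<kappa>\<close>, and at \<open>snd a\<close> it amounts to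
  \<open>symb_star\<close>. With the ends included, each pair \<open>x\<close>,
  \<open>psl_act (glue a) x\<close> is covered by \<open>a\<close> or by
  \<open>star a\<close>.\<close>

lemma \<psi>_crossing_order2:
  assumes a: "a \<in> V" "\<not> order3 a" and y: "orient a y \<le> 0"
  shows "\<psi> y - (translate (glue a) (\<psi> (psl_act (inv\<^bsub>PSL2Z\<^esub> (glue a)) y)) + \<kappa> a) \<in> N"
proof -
  have sa: "star a \<in> V" using a star_closed by blast
  have g: "glue a \<in> carrier PSL2Z" using a glue_carrier by blast
  have inv: "psl_act (inv\<^bsub>PSL2Z\<^esub> (glue a)) (snd a) = fst (star a)"
    "psl_act (inv\<^bsub>PSL2Z\<^esub> (glue a)) (fst a) = snd (star a)"
    using psl_act_inv(1)[OF g] glue_order2(1,2)[OF a] by metis+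
  consider "orient a y < 0" | "y = fst a" | "y = snd a"
    using y orient_eq_0_iff[OF side_distinct[OF a(1)], of y] by fastforce
  then show ?thesis
  proof cases
    case 1
    then have "crossed_side y = a" using crossed_side_eq a by blast
    then show ?thesis
      using \<psi>_cross[OF not_vertex[OF a(1) 1]] a N_zero by (simp add: crossing_def Let_def)
  next
    case 2
    then show ?thesis
      using inv N_zero vertices[OF a(1)] vertices[OF sa] by (simp add: \<psi>_vertex \<kappa>_eq)
  next
    case 3
    have "symb \<one>\<^bsub>PSL2Z\<^esub> a + symb (glue a) (star a) \<in> N" using symb_star[OF a] .
    moreover have "translate (glue a) (p (snd (star a)) - p (fst (star a)) - symb \<one>\<^bsub>PSL2Z\<^esub> (star a)) \<in> N"
      using N_translate[OF glue_\<Gamma>[OF a(1)] p_side[OF sa]] .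
    moreover have "translate (glue a) (symb \<one>\<^bsub>PSL2Z\<^esub> (star a)) = symb (glue a) (star a)"
      using translate_symb[OF g _ sa, of "\<one>\<^bsub>PSL2Z\<^esub>"] monoid.r_one[OF group.is_monoid[OF group_PSL2Z] g]
        monoid.one_closed[OF group.is_monoid[OF group_PSL2Z]] by simp
    moreover note p_side[OF a(1)]
    ultimately have "(p (snd a) - p (fst a) - symb \<one>\<^bsub>PSL2Z\<^esub> a) +
      (translate (glue a) (p (snd (star a))) - translate (glue a) (p (fst (star a))) - symb (glue a) (star a)) +
      (symb \<one>\<^bsub>PSL2Z\<^esub> a + symb (glue a) (star a)) \<in> N"
      unfolding translate_diff by (simp only: N_add)
    then show ?thesis unfolding 3 inv
      using vertices[OF a(1)] vertices[OF sa] by (simp add: \<psi>_vertex \<kappa>_eq algebra_simps)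
  qed
qed

text \<open>The cocycle condition for the product of \<open>glue a\<close> and
  \<open>glue (star a)\<close> being 1, read off from \<open>\<psi>_crossing_order2\<close> at
  \<open>snd a\<close>.\<close>

lemma \<kappa>_star:
  assumes a: "a \<in> V" "\<not> order3 a"
  shows "translate (glue a) (\<kappa> (star a)) + \<kappa> a \<in> N"
proof -
  interpret group PSL2Z by (rule group_PSL2Z)
  have sa: "star a \<in> V" using a star_closed by blast
  have g: "glue a \<in> carrier PSL2Z" using a glue_carrier by blast
  have inv: "psl_act (inv\<^bsub>PSL2Z\<^esub> (glue a)) (snd a) = fst (star a)"
    using psl_act_inv(1)[OF g] glue_order2(1)[OF a] by metis
  have "orient a (snd a) \<le> 0" by (simp add: orient_def)
  from \<psi>_crossing_order2[OF a this]
  have "p (snd a) - (translate (glue a) (p (fst (star a))) + \<kappa> a) \<in> N"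
    unfolding inv using vertices[OF a(1)] vertices[OF sa] by (simp add: \<psi>_vertex)
  moreover have "translate (glue a) (\<kappa> (star a)) = translate (glue a) (p (fst (star a))) - p (snd a)"
    unfolding \<kappa>_eq[of "star a"] translate_diff star_star[OF a(1)] glue_star[OF a]
    using g p_chains by (simp add: translate_translate translate_one)
  ultimately show ?thesis using N_minus[of "p (snd a) - (translate (glue a) (p (fst (star a))) + \<kappa> a)"]
    by (simp add: diff_add_eq)
qed

lemma equivariant_order2:
  assumes a: "a \<in> V" "\<not> order3 a"
  shows "\<psi> (psl_act (glue a) x) - (translate (glue a) (\<psi> x) + \<kappa> a) \<in> N"
proof -
  interpret group PSL2Z by (rule group_PSL2Z)
  let ?g = "glue a" and ?y = "psl_act (glue a) x"
  have sa: "star a \<in> V" using a star_closed by blast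
  have g: "?g \<in> carrier PSL2Z" using a glue_carrier by blast
  show ?thesis
  proof (cases "orient a ?y \<le> 0")
    case True
    from \<psi>_crossing_order2[OF a True] show ?thesis using g by (simp add: psl_act_inv)
  next
    case False
    \<comment> \<open>Now \<open>x\<close> lies behind \<open>star a\<close>; the equation there is
      translated back by \<open>glue a\<close>, and \<open>\<kappa>_star\<close> disposes of the two
      corrections.\<close>
    have "sgn (orient (snd a, fst a) ?y) = sgn (orient (star a) x)"
      using psl_act_orient[OF g, of "fst (star a)" "snd (star a)" x] glue_order2[OF a] by simp
    moreover have "orient (snd a, fst a) ?y < 0"
      using False orient_swap[of a ?y] by (simp add: prod.swap_def)
    ultimately have "orient (star a) x \<le> 0" by (simp add: sgn_if split: if_splits)
    from \<psi>_crossing_order2[OF sa order3_star[OF a] this]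
    have "\<psi> x - (translate (inv\<^bsub>PSL2Z\<^esub> ?g) (\<psi> ?y) + \<kappa> (star a)) \<in> N"
      unfolding glue_star[OF a] using g by simp
    from N_translate[OF glue_\<Gamma>[OF a(1)] this]
    have "translate ?g (\<psi> x) - (\<psi> ?y + translate ?g (\<kappa> (star a))) \<in> N"
      using g \<psi>_chains by (simp add: translate_diff translate_add translate_translate translate_one)
    from N_minus[OF N_add[OF this \<kappa>_star[OF a]]] show ?thesis by (simp add: algebra_simps)
  qed
qed

text \<open>Since the cube of the gluing is 1, regrouping the sum gives minus the three translates
  of \<open>p (snd a) - p (fst a)\<close>. Modulo \<open>N\<close> these are the symbols in the
  elliptic relation.\<close>

lemma \<kappa>_order3:
  assumes a: "a \<in> V" "order3 a"
  shows "\<kappa> a + translate (glue a) (\<kappa> a) + translate (glue a \<otimes>\<^bsub>PSL2Z\<^esub> glue a) (\<kappa> a) \<in> N"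
proof -
  interpret group PSL2Z by (rule group_PSL2Z)
  let ?g = "glue a"
  have g: "?g \<in> carrier PSL2Z" using a glue_carrier by blast
  have star: "star a = a" "mu a = 3" and ell: "a \<in> elliptic_arcs V star"
    using a by (auto simp: order3_def elliptic_arcs_def)
  have rel: "frag_of (\<one>\<^bsub>PSL2Z\<^esub>, a) + frag_of (?g, a) + frag_of (?g \<otimes>\<^bsub>PSL2Z\<^esub> ?g, a) \<in> N"
    using N_elliptic[OF ell] star g by (simp add: numeral_3_eq_3)
  define w where "w = p (snd a) - p (fst a) - symb \<one>\<^bsub>PSL2Z\<^esub> a"
  have w: "w \<in> N" using p_side[OF a(1)] by (simp add: w_def)
  have "w + translate ?g w + translate (?g \<otimes>\<^bsub>PSL2Z\<^esub> ?g) w +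
    (frag_of (\<one>\<^bsub>PSL2Z\<^esub>, a) + frag_of (?g, a) + frag_of (?g \<otimes>\<^bsub>PSL2Z\<^esub> ?g, a)) \<in> N"
    using N_translate[OF glue_\<Gamma>[OF a(1)] w] N_translate[OF \<Gamma>_mult[OF glue_\<Gamma>[OF a(1)] glue_\<Gamma>[OF a(1)]] w] w
    by (simp only: N_add rel)
  moreover have "symb \<one>\<^bsub>PSL2Z\<^esub> a = frag_of (\<one>\<^bsub>PSL2Z\<^esub>, a)" using ell by (simp add: symb_def)
  ultimately have *: "p (snd a) - p (fst a) + translate ?g (p (snd a)) - translate ?g (p (fst a))
      + translate (?g \<otimes>\<^bsub>PSL2Z\<^esub> ?g) (p (snd a)) - translate (?g \<otimes>\<^bsub>PSL2Z\<^esub> ?g) (p (fst a)) \<in> N"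
    using g unfolding w_def translate_diff by (simp add: algebra_simps)
  have "?g \<otimes>\<^bsub>PSL2Z\<^esub> ?g \<otimes>\<^bsub>PSL2Z\<^esub> ?g = \<one>\<^bsub>PSL2Z\<^esub>" using glue_order3(4)[OF a] .
  then have "translate (?g \<otimes>\<^bsub>PSL2Z\<^esub> ?g) (translate ?g (p (snd a))) = p (snd a)"
    using g p_chains by (simp add: translate_translate translate_one)
  with N_minus[OF *] show ?thesis
    unfolding \<kappa>_eq star translate_diff using g p_chains by (simp add: translate_translate algebra_simps)
qed

text \<open>The gluing permutes the triangle sides cyclically, \<open>(r, s)\<close> to
  \<open>(t, r)\<close> to \<open>(s, t)\<close> to \<open>(r, s)\<close>, and with them the regions
  beyond these sides. The region of \<open>x\<close> decides how the recursion treats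
  \<open>x\<close> and its image.\<close>

lemma equivariant_order3:
  assumes a: "a \<in> V" "order3 a"
  shows "\<psi> (psl_act (glue a) x) - (translate (glue a) (\<psi> x) + \<kappa> a) \<in> N"
proof -
  interpret group PSL2Z by (rule group_PSL2Z)
  define g r s t where d: "g = glue a" "r = fst a" "s = snd a" "t = psl_act g r"
  define gg where "gg = g \<otimes>\<^bsub>PSL2Z\<^esub> g"
  have ar: "a = (r, s)" by (simp add: d)
  have g: "g \<in> carrier PSL2Z" and gg: "gg \<in> carrier PSL2Z" using a glue_carrier by (auto simp: d gg_def)
  have act: "psl_act g s = r" "psl_act g r = t" "psl_act g t = s" and rst: "orient (r, s) t < 0"
    using glue_order3(1-3)[OF a] by (simp_all add: d)
  have ggg: "gg \<otimes>\<^bsub>PSL2Z\<^esub> g = \<one>\<^bsub>PSL2Z\<^esub>" using glue_order3(4)[OF a] by (simp add: gg_def d)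
  have inv_gg: "inv\<^bsub>PSL2Z\<^esub> gg = g" using ggg g gg by (metis inv_comm inv_equality)
  have star: "star a = a" using a by (simp add: order3_def)
  have pr: "\<psi> r = p r" "\<psi> s = p s" using vertices[OF a(1)] by (simp_all add: \<psi>_vertex d)
  have \<kappa>: "\<kappa> a = p r - translate g (p s)" by (simp add: \<kappa>_eq star d)
  have \<kappa>3: "\<kappa> a + translate g (\<kappa> a) + translate gg (\<kappa> a) \<in> N"
    using \<kappa>_order3[OF a] by (simp add: d gg_def)
  have first: "\<psi> c = translate g (\<psi> (psl_act (inv\<^bsub>PSL2Z\<^esub> g) c)) + \<kappa> a"
    if "orient (r, s) c < 0" "\<not> orient (t, r) c < 0" for c
  proof -
    have "orient a c < 0" using that ar by simp
    then have "crossed_side c = a" using crossed_side_eq a by blast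
    then show ?thesis
      using \<psi>_cross[OF not_vertex[OF a(1) \<open>orient a c < 0\<close>]] a that by (simp add: crossing_def Let_def d)
  qed
  have second: "\<psi> c = translate gg (\<psi> (psl_act g c)) + \<kappa> a + translate g (\<kappa> a)"
    if "orient (r, s) c < 0" "orient (t, r) c < 0" for c
  proof -
    have "orient a c < 0" using that ar by simp
    then have "crossed_side c = a" using crossed_side_eq a by blast
    then show ?thesis
      using \<psi>_cross[OF not_vertex[OF a(1) \<open>orient a c < 0\<close>]] a that inv_gg
      by (simp add: crossing_def Let_def d gg_def algebra_simps)
  qed
  have or: "orient (psl_act g u, psl_act g v) (psl_act g c) > 0 \<longleftrightarrow> orient (u, v) c > 0" for u v c
    using psl_act_orient[OF g, of u v c] by (auto simp: sgn_if split: if_splits)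
  have t: "\<psi> t = translate g (p r) + \<kappa> a"
  proof -
    have "psl_act (inv\<^bsub>PSL2Z\<^esub> g) t = r" using psl_act_inv(1)[OF g] act by metis
    moreover have "orient (t, r) t = 0" by (simp add: orient_def)
    ultimately show ?thesis using first[OF rst] pr by simp
  qed
  have inj: "psl_act g c \<in> {r, s, t} \<longleftrightarrow> c \<in> {r, s, t}" for c
    using psl_act_inv(1)[OF g] act by (metis insert_iff singletonD)
  have "\<psi> (psl_act g x) - (translate g (\<psi> x) + \<kappa> a) \<in> N"
  proof (cases "x \<in> {r, s, t}")
    case True
    then consider "x = r" | "x = s" | "x = t" by blast
    then show ?thesis
    proof cases
      case 1
      then show ?thesis using t act pr N_zero by simp
    next
      case 2
      then show ?thesis using act pr \<kappa> N_zero by simp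
    next
      case 3
      have "translate gg (\<kappa> a) = translate gg (p r) - p s"
        unfolding \<kappa> translate_diff using g gg ggg p_chains by (simp add: translate_translate translate_one)
      moreover have "translate g (\<psi> t) = translate gg (p r) + translate g (\<kappa> a)"
        using t g p_chains by (simp add: translate_add translate_translate gg_def)
      ultimately have "\<psi> (psl_act g x) - (translate g (\<psi> x) + \<kappa> a) = - (\<kappa> a + translate g (\<kappa> a) + translate gg (\<kappa> a))"
        using 3 act pr by (simp add: algebra_simps)
      then show ?thesis using N_minus[OF \<kappa>3] by (simp only:)
    qed
  next
    case False
    let ?y = "psl_act g x"
    have y: "?y \<notin> {r, s, t}" using False inj by blast
    note tri = triangle_orient[OF rst False] and tri_y = triangle_orient[OF rst y]
    have sh: "orient (t, r) ?y > 0 \<longleftrightarrow> orient (r, s) x > 0" "orient (s, t) ?y > 0 \<longleftrightarrow> orient (t, r) x > 0"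
      "orient (r, s) ?y > 0 \<longleftrightarrow> orient (s, t) x > 0"
      using or[of r s x] or[of t r x] or[of s t x] act by simp_all
    consider "orient (r, s) x > 0" | "orient (r, s) x < 0" "orient (s, t) x < 0" "orient (t, r) x > 0" | "orient (r, s) x < 0" "orient (s, t) x > 0" "orient (t, r) x < 0"
      using tri by blast
    then show ?thesis
    proof cases
      case 1
      \<comment> \<open>\<open>x\<close> is on the polygon's side of \<open>a\<close>, and the
        recursion at its image crosses by \<open>g\<close> straight back to
        \<open>x\<close>.\<close>
      then have "orient (t, r) ?y > 0" "orient (r, s) ?y < 0" using sh tri_y tri by auto
      then show ?thesis using first[of ?y] psl_act_inv(1)[OF g] N_zero by simp
    next
      case 2
      \<comment> \<open>Both points lie behind \<open>a\<close>: the image crosses by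
        \<open>gg\<close>, \<open>x\<close> by \<open>g\<close>, and they arrive at the same
        cusp.\<close>
      then have "orient (s, t) ?y > 0" "orient (r, s) ?y < 0" "orient (t, r) ?y < 0" using sh tri_y tri by auto
      then have "\<psi> ?y = translate gg (\<psi> (psl_act g ?y)) + \<kappa> a + translate g (\<kappa> a)" using second by blast
      moreover have "\<psi> x = translate g (\<psi> (psl_act (inv\<^bsub>PSL2Z\<^esub> g) x)) + \<kappa> a" using first 2 by simp
      moreover have "psl_act g ?y = psl_act (inv\<^bsub>PSL2Z\<^esub> g) x"
      proof -
        have "psl_act g ?y = psl_act gg x" using g by (simp add: psl_act_mult gg_def)
        moreover have "gg = inv\<^bsub>PSL2Z\<^esub> g" using ggg g gg by (metis inv_equality)
        ultimately show ?thesis by simp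
      qed
      ultimately show ?thesis
        using N_zero g \<psi>_chains by (simp add: translate_add translate_translate gg_def)
    next
      case 3
      \<comment> \<open>Only \<open>x\<close> lies behind \<open>a\<close> and crosses by
        \<open>gg\<close> to its image, so the three corrections accumulate and are removed by
        \<open>\<kappa>3\<close>.\<close>
      have "translate g (\<psi> x) = \<psi> ?y + translate g (\<kappa> a) + translate gg (\<kappa> a)"
      proof -
        have "g \<otimes>\<^bsub>PSL2Z\<^esub> gg = \<one>\<^bsub>PSL2Z\<^esub>" using ggg g gg by (metis inv_comm)
        then show ?thesis using second[of x] 3 g gg \<psi>_chains \<kappa>_chains[OF a(1)]
          by (simp add: translate_add translate_translate translate_one) (simp add: gg_def)
      qed
      then have "\<psi> ?y - (translate g (\<psi> x) + \<kappa> a) = - (\<kappa> a + translate g (\<kappa> a) + translate gg (\<kappa> a))"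
        by (simp add: algebra_simps)
      then show ?thesis using N_minus[OF \<kappa>3] by (simp only:)
    qed
  qed
  then show ?thesis by (simp add: d)
qed

lemma equivariant:
  assumes "g \<in> \<Gamma>"
  shows "\<exists>k \<in> psl_chains. \<forall>x. \<psi> (psl_act g x) - (translate g (\<psi> x) + k) \<in> N"
  using assms
proof (induction g rule: generate.induct)
  case one
  then show ?case
    by (intro bexI[of _ 0]) (simp_all add: psl_act_one translate_one \<psi>_chains N_zero psl_chains_0)
next
  case (incl h)
  then obtain a where a: "a \<in> V" "h = glue a" by auto
  then show ?case using equivariant_order2 equivariant_order3 \<kappa>_chains[OF a(1)] by blast
next
  case (inv h)
  interpret group PSL2Z by (rule group_PSL2Z)
  obtain a where a: "a \<in> V" "h = glue a" using inv by auto
  then have h: "h \<in> carrier PSL2Z" "h \<in> \<Gamma>" using glue_carrier glue_\<Gamma> by auto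
  have *: "\<psi> (psl_act h x) - (translate h (\<psi> x) + \<kappa> a) \<in> N" for x
    using equivariant_order2 equivariant_order3 a by blast
  show ?case
  proof (intro bexI allI)
    fix x
    let ?i = "inv\<^bsub>PSL2Z\<^esub> h"
    from N_minus[OF N_translate[OF \<Gamma>_inv[OF h(2)] *[of "psl_act ?i x"]]]
    show "\<psi> (psl_act ?i x) - (translate ?i (\<psi> x) + (- translate ?i (\<kappa> a))) \<in> N"
      using h \<psi>_chains by (simp add: psl_act_inv translate_diff translate_add translate_translate translate_one algebra_simps)
  qed (use h \<kappa>_chains[OF a(1)] in \<open>auto intro!: psl_chains_minus psl_chains_translate\<close>)
next
  case (eng g h)
  interpret group PSL2Z by (rule group_PSL2Z)
  have gh: "g \<in> carrier PSL2Z" "h \<in> carrier PSL2Z" using eng \<Gamma>_carrier by auto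
  obtain k where k: "k \<in> psl_chains" "\<And>x. \<psi> (psl_act g x) - (translate g (\<psi> x) + k) \<in> N" using eng.IH(1) by blast
  obtain l where l: "l \<in> psl_chains" "\<And>x. \<psi> (psl_act h x) - (translate h (\<psi> x) + l) \<in> N" using eng.IH(2) by blast
  show ?case
  proof (intro bexI allI)
    fix x
    from N_add[OF k(2)[of "psl_act h x"] N_translate[OF eng.hyps(1) l(2)[of x]]]
    show "\<psi> (psl_act (g \<otimes>\<^bsub>PSL2Z\<^esub> h) x) - (translate (g \<otimes>\<^bsub>PSL2Z\<^esub> h) (\<psi> x) + (translate g l + k)) \<in> N"
      using gh \<psi>_chains by (simp add: psl_act_mult translate_diff translate_add translate_translate algebra_simps)
  qed (use gh k l in \<open>auto intro!: psl_chains_add psl_chains_translate\<close>)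
qed

text \<open>The same correction \<open>k\<close> occurs at both ends of \<open>a\<close> and
  cancels; what remains is the translate of \<open>p_side\<close>.\<close>

lemma \<psi>_symb:
  assumes g: "g \<in> \<Gamma>" and a: "a \<in> V"
  shows "\<psi> (psl_act g (snd a)) - \<psi> (psl_act g (fst a)) - symb g a \<in> N"
proof -
  interpret group PSL2Z by (rule group_PSL2Z)
  obtain k where k: "\<And>x. \<psi> (psl_act g x) - (translate g (\<psi> x) + k) \<in> N" using equivariant[OF g] by blast
  have "translate g (\<psi> (snd a) - \<psi> (fst a) - symb \<one>\<^bsub>PSL2Z\<^esub> a) \<in> N"
    using N_translate[OF g p_side[OF a]] vertices[OF a] by (simp add: \<psi>_vertex)
  from N_add[OF N_diff[OF k[of "snd a"] k[of "fst a"]] this]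
  show ?thesis using \<Gamma>_carrier[OF g] a
    unfolding translate_diff by (simp add: translate_symb algebra_simps)
qed

end

definition chain_boundary :: "symbol_chain \<Rightarrow> (cusp \<Rightarrow>\<^sub>0 int)" where
  "chain_boundary = frag_extend (\<lambda>(g, a). frag_of (psl_act g (snd a)) - frag_of (psl_act g (fst a)))"

lemma (in farey_chains) boundary_zero_imp_relation:
  assumes "Poly_Mapping.keys x \<subseteq> \<Gamma> \<times> (E \<union> elliptic_arcs V star)" "chain_boundary x = 0"
  shows "x \<in> N"
proof -
  interpret group PSL2Z by (rule group_PSL2Z)
  obtain rs where rs: "distinct rs" "V = polygon_sides rs"
    using polygon by (auto simp: convex_ideal_polygon_def)
  obtain p where p: "\<And>v. \<exists>B\<subseteq>V. p v = sum (symb \<one>\<^bsub>PSL2Z\<^esub>) B"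
    "\<And>a. a \<in> V \<Longrightarrow> p (snd a) - p (fst a) = symb \<one>\<^bsub>PSL2Z\<^esub> a \<or>
      p (snd a) - p (fst a) = symb \<one>\<^bsub>PSL2Z\<^esub> a - sum (symb \<one>\<^bsub>PSL2Z\<^esub>) V"
    using polygon_potential[OF rs(1), of "symb \<one>\<^bsub>PSL2Z\<^esub>"] unfolding rs(2) by blast
  define \<kappa> where "\<kappa> a = p (fst a) - translate (glue a) (p (snd (star a)))" for a
  define step where "step c y = (let b = crossed_side c in translate (crossing c) y +
      (if order3 b \<and> orient (apex b, fst b) c < 0 then \<kappa> b + translate (glue b) (\<kappa> b) else \<kappa> b))" for c y
  obtain \<psi> where \<psi>: "\<And>c. c \<in> fst ` V \<Longrightarrow> \<psi> c = p c"
    "\<And>c. c \<notin> fst ` V \<Longrightarrow> \<psi> c = step c (\<psi> (psl_act (inv\<^bsub>PSL2Z\<^esub> (crossing c)) c))"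
    using measure_recursion[of "fst ` V" height "\<lambda>c. psl_act (inv\<^bsub>PSL2Z\<^esub> (crossing c)) c" p step]
      height_crossing by blast
  have "farey_cocycle V star mu E N p \<psi> \<kappa>"
  proof (unfold_locales)
    fix v
    obtain B where "B \<subseteq> V" "p v = sum (symb \<one>\<^bsub>PSL2Z\<^esub>) B" using p(1) by blast
    then show "p v \<in> psl_chains" by (auto intro!: psl_chains_sum symb_chains)
  next
    fix a assume "a \<in> V"
    \<comment> \<open>The defect of the potential on the closing side is the boundary
      relation.\<close>
    have "sum (symb \<one>\<^bsub>PSL2Z\<^esub>) V \<in> N" using N_boundary symb_boundary by simp
    then show "p (snd a) - p (fst a) - symb \<one>\<^bsub>PSL2Z\<^esub> a \<in> N"
      using p(2)[OF \<open>a \<in> V\<close>] N_zero N_minus by auto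
  qed (simp_all add: \<kappa>_def \<psi> step_def Let_def)
  then interpret farey_cocycle V star mu E N p \<psi> \<kappa> .
  have "x - frag_extend \<psi> (chain_boundary x) \<in> N"
    using assms(1)
  proof (induction x rule: frag_induction)
    case zero
    then show ?case by (simp add: chain_boundary_def N_zero)
  next
    case (one z)
    obtain g a where z: "z = (g, a)" "g \<in> \<Gamma>" "a \<in> E \<union> elliptic_arcs V star" using one by auto
    have "a \<in> V" using z(3) E_props(1)[of a] by (auto simp: elliptic_arcs_def)
    from N_minus[OF \<psi>_symb[OF z(2) this]] show ?case
      using z by (simp add: chain_boundary_def frag_extend_diff symb_def)
  next
    case (diff x y)
    then show ?case using N_diff[OF diff] by (simp add: chain_boundary_def frag_extend_diff algebra_simps)
  qed
  then show ?thesis using assms(2) by simp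
qed

section \<open>Presentation of the module\<close>

lemma left_module_first_iso:
  assumes M: "left_module R M" and L: "abelian_group L" and N: "submodule N R M"
    and add: "\<And>x y. x \<in> carrier M \<Longrightarrow> y \<in> carrier M \<Longrightarrow> \<Phi> (x \<oplus>\<^bsub>M\<^esub> y) = \<Phi> x \<oplus>\<^bsub>L\<^esub> \<Phi> y"
    and smult: "\<And>r x. r \<in> carrier R \<Longrightarrow> x \<in> carrier M \<Longrightarrow> \<Phi> (r \<odot>\<^bsub>M\<^esub> x) = r \<odot>\<^bsub>L\<^esub> \<Phi> x"
    and surj: "\<Phi> ` carrier M = carrier L"
    and ker: "\<And>x. x \<in> carrier M \<Longrightarrow> \<Phi> x = \<zero>\<^bsub>L\<^esub> \<longleftrightarrow> x \<in> N"
  shows "\<exists>\<phi> \<in> left_module_iso R (quotient_module M N) L. \<forall>x \<in> carrier M. \<phi> (N +>\<^bsub>M\<^esub> x) = \<Phi> x"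
proof -
  interpret M: left_module R M by fact
  interpret L: abelian_group L by fact
  interpret N: submodule N R M by fact
  interpret S: abelian_subgroup N M
    by (intro abelian_subgroupI3 additive_subgroupI N.subgroup_axioms M.M.abelian_group_axioms)
  have \<Phi>c: "\<Phi> x \<in> carrier L" if "x \<in> carrier M" for x using that surj by blast
  have coset: "N +>\<^bsub>M\<^esub> x = {n \<oplus>\<^bsub>M\<^esub> x | n. n \<in> N}" for x by (auto simp: a_r_coset_def')
  have Nc: "n \<in> carrier M" if "n \<in> N" for n using that N.subset by auto
  define \<phi> where "\<phi> C = the_elem (\<Phi> ` C)" for C
  have \<Phi>N: "\<Phi> (n \<oplus>\<^bsub>M\<^esub> x) = \<Phi> x" if "n \<in> N" "x \<in> carrier M" for n x
    using add[OF Nc[OF that(1)] that(2)] ker[OF Nc[OF that(1)]] that(1) \<Phi>c[OF that(2)] by simp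
  have \<phi>: "\<phi> (N +>\<^bsub>M\<^esub> x) = \<Phi> x" if x: "x \<in> carrier M" for x
  proof -
    have "x \<in> N +>\<^bsub>M\<^esub> x" using S.a_rcos_self[OF x] .
    then have "\<Phi> ` (N +>\<^bsub>M\<^esub> x) = {\<Phi> x}" unfolding coset using \<Phi>N x by auto
    then show ?thesis by (simp add: \<phi>_def)
  qed
  have carr: "carrier (quotient_module M N) = (\<lambda>x. N +>\<^bsub>M\<^esub> x) ` carrier M"
    by (auto simp: quotient_module_def A_RCOSETS_def')
  have eqI: "N +>\<^bsub>M\<^esub> x = N +>\<^bsub>M\<^esub> y" if xy: "x \<in> carrier M" "y \<in> carrier M" "\<Phi> x = \<Phi> y" for x y
  proof -
    have "\<Phi> (x \<oplus>\<^bsub>M\<^esub> \<ominus>\<^bsub>M\<^esub> y) = \<Phi> y \<oplus>\<^bsub>L\<^esub> \<Phi> (\<ominus>\<^bsub>M\<^esub> y)"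
      using xy(1,2) by (simp add: add xy(3))
    also have "\<dots> = \<Phi> (y \<oplus>\<^bsub>M\<^esub> \<ominus>\<^bsub>M\<^esub> y)"
      using xy(2) by (simp only: add M.a_inv_closed)
    also have "\<dots> = \<zero>\<^bsub>L\<^esub>" using xy(2) ker[of "\<zero>\<^bsub>M\<^esub>"] S.zero_closed by (simp add: M.r_neg)
    finally have "x \<oplus>\<^bsub>M\<^esub> \<ominus>\<^bsub>M\<^esub> y \<in> N"
      using ker[of "x \<oplus>\<^bsub>M\<^esub> \<ominus>\<^bsub>M\<^esub> y"] xy by simp
    from S.a_rcos_module_rev[OF xy(2,1) this] have "x \<in> N +>\<^bsub>M\<^esub> y" .
    from M.a_repr_independence[OF this xy(2) S.a_subgroup] show ?thesis by (rule sym)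
  qed
  have "bij_betw \<phi> (carrier (quotient_module M N)) (carrier L)"
    unfolding bij_betw_def carr
  proof (rule conjI)
    show "inj_on \<phi> ((\<lambda>x. N +>\<^bsub>M\<^esub> x) ` carrier M)"
    proof (rule inj_onI, elim imageE)
      fix C D x y assume "\<phi> C = \<phi> D" "C = N +>\<^bsub>M\<^esub> x" "D = N +>\<^bsub>M\<^esub> y" "x \<in> carrier M" "y \<in> carrier M"
      then show "C = D" using eqI[of x y] by (simp only: \<phi>)
    qed
    show "\<phi> ` (\<lambda>x. N +>\<^bsub>M\<^esub> x) ` carrier M = carrier L"
      unfolding image_image surj[symmetric] by (rule image_cong) (simp_all add: \<phi>)
  qed
  moreover have "\<phi> (C \<oplus>\<^bsub>quotient_module M N\<^esub> D) = \<phi> C \<oplus>\<^bsub>L\<^esub> \<phi> D"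
    if CD: "C \<in> carrier (quotient_module M N)" "D \<in> carrier (quotient_module M N)" for C D
  proof -
    obtain x y where "x \<in> carrier M" "y \<in> carrier M" "C = N +>\<^bsub>M\<^esub> x" "D = N +>\<^bsub>M\<^esub> y"
      using CD carr by auto
    then show ?thesis by (simp add: quotient_module_def S.a_rcos_sum \<phi> add)
  qed
  moreover have "\<phi> (r \<odot>\<^bsub>quotient_module M N\<^esub> C) = r \<odot>\<^bsub>L\<^esub> \<phi> C"
    if r: "r \<in> carrier R" and C: "C \<in> carrier (quotient_module M N)" for r C
  proof -
    obtain x where x: "x \<in> carrier M" "C = N +>\<^bsub>M\<^esub> x" using C carr by auto
    have Cc: "z \<in> carrier M" "\<Phi> z = \<Phi> x" if "z \<in> C" for z
      using that x(1) Nc \<Phi>N unfolding x(2) coset by auto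
    \<comment> \<open>The scalar multiplication of the quotient is a union over all representatives;
      every one of them yields the same coset.\<close>
    have "N +>\<^bsub>M\<^esub> (r \<odot>\<^bsub>M\<^esub> z) = N +>\<^bsub>M\<^esub> (r \<odot>\<^bsub>M\<^esub> x)" if "z \<in> C" for z
      by (intro eqI M.smult_closed r Cc[OF that] x(1)) (simp only: smult r Cc[OF that] x(1))
    moreover have "x \<in> C" using S.a_rcos_self x by simp
    ultimately have "r \<odot>\<^bsub>quotient_module M N\<^esub> C = N +>\<^bsub>M\<^esub> (r \<odot>\<^bsub>M\<^esub> x)"
      unfolding quotient_module_def module.simps by blast
    then show ?thesis using x r smult by (simp add: \<phi> M.smult_closed)
  qed
  ultimately have "\<phi> \<in> left_module_iso R (quotient_module M N) L"
    by (simp add: left_module_iso_def)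
  then show ?thesis using \<phi> by blast
qed

lemma submodule_generated_submodule:
  assumes M: "left_module R M" and S: "S \<subseteq> carrier M"
  shows "submodule (generated_submodule R M S) R M"
proof -
  interpret M: left_module R M by fact
  let ?F = "{N. submodule N R M \<and> S \<subseteq> N}"
  have "subgroup (carrier M) (add_monoid M)" using M.add.subgroup_self by simp
  then have "submodule (carrier M) R M"
    by (intro submodule.intro submodule_axioms.intro) (auto simp: M.smult_closed)
  then have ne: "carrier M \<in> ?F" using S by simp
  have "subgroup (\<Inter>?F) (add_monoid M)"
    using ne by (intro M.add.subgroups_Inter) (auto simp: submodule_def)
  then show ?thesis unfolding generated_submodule_def
    by (intro submodule.intro submodule_axioms.intro) (auto simp: submodule.smult_closed)
qed

definition divisor_act :: "mat2 set \<Rightarrow> (cusp \<Rightarrow>\<^sub>0 int) \<Rightarrow> (cusp \<Rightarrow>\<^sub>0 int)" where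
  "divisor_act g = frag_extend (\<lambda>c. frag_of (psl_act g c))"

text \<open>Congruence of cusps modulo \<open>I\<close> is an equivalence relation stable under
  \<open>\<Gamma>\<close>. The sides make all vertices congruent, each gluing takes some vertex to a
  vertex and so preserves the class of \<open>Infty\<close>, and the descent brings every cusp into
  this class.\<close>

lemma (in extended_farey_symbol) degree_zero_generated:
  assumes zero: "0 \<in> I" and diff: "\<And>x y. x \<in> I \<Longrightarrow> y \<in> I \<Longrightarrow> x - y \<in> I"
    and act: "\<And>g x. g \<in> \<Gamma> \<Longrightarrow> x \<in> I \<Longrightarrow> divisor_act g x \<in> I"
    and sides: "\<And>a. a \<in> V \<Longrightarrow> arc_divisor a \<in> I"
    and D: "divisor_degree D = 0"
  shows "D \<in> I"
proof -
  define rel where "rel c d \<longleftrightarrow> frag_of c - frag_of d \<in> I" for c d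
  have refl: "rel c c" for c using zero by (simp add: rel_def)
  have sym: "rel d c" if "rel c d" for c d
    using diff[OF zero, of "frag_of c - frag_of d"] that by (simp add: rel_def)
  have trans: "rel c e" if "rel c d" "rel d e" for c d e
    using diff[of "frag_of c - frag_of d" "frag_of e - frag_of d"] that sym[OF that(2)] by (simp add: rel_def)
  have rel_act: "rel (psl_act g c) (psl_act g d)" if "rel c d" "g \<in> \<Gamma>" for g c d
    using act[OF that(2), of "frag_of c - frag_of d"] that by (simp add: rel_def divisor_act_def frag_extend_diff)
  obtain rs where rs: "distinct rs" "V = polygon_sides rs"
    using polygon by (auto simp: convex_ideal_polygon_def)
  have "rel (rs ! i) (rs ! 0)" if "i < length rs" for i
    using that
  proof (induction i)
    case (Suc i)
    then have "(rs ! i, rs ! Suc i) \<in> V" unfolding rs polygon_sides_nth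
      by (auto intro!: image_eqI[of _ _ i])
    then have "rel (rs ! Suc i) (rs ! i)" using sides by (auto simp: rel_def arc_divisor_def)
    then show ?case using Suc trans by auto
  qed (rule refl)
  then have vv0: "rel v (rs ! 0)" if "v \<in> fst ` V" for v
    using that unfolding rs(2) polygon_sides_images by (auto simp: in_set_conv_nth)
  have vv: "rel v w" if "v \<in> fst ` V" "w \<in> fst ` V" for v w
    using trans[OF vv0[OF that(1)] sym[OF vv0[OF that(2)]]] .
  have inf: "Infty \<in> fst ` V" using base_arc by (metis fst_conv imageI)
  have vert: "fst a \<in> fst ` V" "snd a \<in> fst ` V" if "a \<in> V" for a using that fst_snd_V by auto
  have glue_rel: "rel (psl_act (glue b) Infty) Infty" if b: "b \<in> V" for b
  proof -
    have sb: "star b \<in> V" using b star_closed by blast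
    have "\<exists>v\<in>fst ` V. psl_act (glue b) v \<in> fst ` V"
    proof (cases "order3 b")
      case True
      then show ?thesis using glue_order3(1)[OF b True] vert[OF b] by metis
    next
      case False
      then show ?thesis using glue_order2(1)[OF b False] vert[OF b] vert[OF sb] by metis
    qed
    then obtain v where v: "v \<in> fst ` V" "psl_act (glue b) v \<in> fst ` V" by blast
    show ?thesis using trans[OF rel_act[OF vv[OF inf v(1)] glue_\<Gamma>[OF b]] vv[OF v(2) inf]] .
  qed
  have all: "rel c Infty" for c
  proof (induction "height c" arbitrary: c rule: less_induct)
    case less
    show ?case
    proof (cases "c \<in> fst ` V")
      case True
      then show ?thesis using vv inf by blast
    next
      case False
      let ?b = "crossed_side c" and ?g = "crossing c"
      have b: "?b \<in> V" using crossed_side[OF False] by simp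
      have gb: "glue ?b \<in> \<Gamma>" using glue_\<Gamma>[OF b] .
      have g: "?g \<in> \<Gamma>" using gb \<Gamma>_mult by (simp add: crossing_def Let_def)
      have "rel (psl_act (inv\<^bsub>PSL2Z\<^esub> ?g) c) Infty" using less height_crossing[OF False] by blast
      from rel_act[OF this g] have "rel c (psl_act ?g Infty)"
        using \<Gamma>_carrier[OF g] by (simp add: psl_act_inv)
      moreover have "rel (psl_act ?g Infty) Infty"
      proof (cases "?g = glue ?b")
        case True
        then show ?thesis using glue_rel[OF b] by simp
      next
        case False
        then have "psl_act ?g Infty = psl_act (glue ?b) (psl_act (glue ?b) Infty)"
          using \<Gamma>_carrier[OF gb] by (auto simp: crossing_def Let_def psl_act_mult split: if_splits)
        then show ?thesis using trans[OF rel_act[OF glue_rel[OF b] gb] glue_rel[OF b]] by simp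
      qed
      ultimately show ?thesis using trans by blast
    qed
  qed
  have "frag_extend (\<lambda>c. frag_of c - frag_of Infty) D \<in> I"
    using subset_UNIV[of "Poly_Mapping.keys D"]
    by (induction D rule: frag_induction) (use all in \<open>auto simp: zero diff frag_extend_diff rel_def\<close>)
  moreover have "frag_extend (\<lambda>c. frag_of c - frag_of Infty) D = D - frag_extend (\<lambda>_. frag_of Infty) D" for D :: "cusp \<Rightarrow>\<^sub>0 int"
    using subset_UNIV[of "Poly_Mapping.keys D"]
    by (induction D rule: frag_induction) (auto simp: frag_extend_diff)
  \<comment> \<open>The constant map factors through a one-point set, on which only the degree of
    \<open>D\<close> survives.\<close>
  moreover have "frag_extend (\<lambda>_. frag_of Infty) D = 0"
    using frag_extend_compose[of "\<lambda>_. frag_of Infty" "\<lambda>_. ()" D] D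
    by (simp add: divisor_degree_eq_0_iff o_def)
  ultimately show ?thesis by simp
qed

section \<open>Elements of the free module as chains of symbols\<close>

lemma frag_extend_frag_extend: "frag_extend f (frag_extend g x) = frag_extend (\<lambda>i. frag_extend f (g i)) x"
  using subset_UNIV[of "Poly_Mapping.keys x"]
  by (induction x rule: frag_induction) (simp_all add: frag_extend_diff)

lemma frag_extend_fun_sum: "frag_extend (\<lambda>i. \<Sum>a\<in>A. f a i) x = (\<Sum>a\<in>A. frag_extend (f a) x)"
  using subset_UNIV[of "Poly_Mapping.keys x"]
  by (induction x rule: frag_induction) (simp_all add: frag_extend_diff sum_subtractf)

definition symbols_at :: "arc \<Rightarrow> (mat2 set \<Rightarrow>\<^sub>0 int) \<Rightarrow> symbol_chain" where
  "symbols_at a = frag_extend (\<lambda>g. frag_of (g, a))"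

lemma symbols_at_simps [simp]:
  "symbols_at a 0 = 0" "symbols_at a (frag_of g) = frag_of (g, a)"
  "symbols_at a (x + y) = symbols_at a x + symbols_at a y"
  "symbols_at a (x - y) = symbols_at a x - symbols_at a y"
  by (simp_all add: symbols_at_def frag_extend_add frag_extend_diff)

lemma symbols_at_sum: "symbols_at a (sum f S) = (\<Sum>s\<in>S. symbols_at a (f s))"
  by (induction S rule: infinite_finite_induct) simp_all

lemma symbols_at_keys: "Poly_Mapping.keys (symbols_at a x) \<subseteq> Poly_Mapping.keys x \<times> {a}"
  using keys_frag_extend[of "\<lambda>g. frag_of (g, a)" x] by (auto simp: symbols_at_def)

lemma translate_symbols_at:
  "translate g (symbols_at a x) = symbols_at a (frag_extend (\<lambda>h. frag_of (g \<otimes>\<^bsub>PSL2Z\<^esub> h)) x)"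
  by (simp add: translate_def symbols_at_def frag_extend_frag_extend)

definition free_chain :: "arc set \<Rightarrow> (arc \<Rightarrow> (mat2 set \<Rightarrow>\<^sub>0 int)) \<Rightarrow> symbol_chain" where
  "free_chain A f = (\<Sum>a\<in>A. symbols_at a (f a))"

text \<open>Recovers the coefficients from the chain; this makes \<open>free_chain\<close> injective
  on the free module, so membership in \<open>N\<close> can be pulled back.\<close>

lemma free_chain_component:
  assumes "finite A" "a \<in> A"
  shows "frag_extend (\<lambda>(g, b). if b = a then frag_of g else 0) (free_chain A f) = f a"
proof -
  have *: "frag_extend (\<lambda>(g, b). if b = a then frag_of g else 0) (symbols_at b x) = (if b = a then x else 0)" for b x
    by (simp add: symbols_at_def frag_extend_frag_extend frag_expansion[symmetric] frag_extend_eq_0)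
  have "frag_extend (\<lambda>(g, b). if b = a then frag_of g else 0) (free_chain A f) = (\<Sum>b\<in>A. if b = a then f b else 0)"
    unfolding free_chain_def using assms(1)
    by (subst frag_extend_sum) (simp_all add: * o_def)
  then show ?thesis using assms by simp
qed

lemma chain_boundary_translate:
  assumes "g \<in> carrier PSL2Z" "x \<in> psl_chains"
  shows "chain_boundary (translate g x) = divisor_act g (chain_boundary x)"
proof -
  have "Poly_Mapping.keys x \<subseteq> carrier PSL2Z \<times> UNIV" using assms by (simp add: psl_chains_def)
  then show ?thesis
    by (induction x rule: frag_induction)
      (auto simp: chain_boundary_def divisor_act_def translate_diff frag_extend_diff psl_act_mult assms(1))
qed

lemma chain_boundary_add: "chain_boundary (x + y) = chain_boundary x + chain_boundary y"
  and chain_boundary_0: "chain_boundary 0 = 0"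
  by (simp_all add: chain_boundary_def frag_extend_add)

lemma chain_boundary_sum: "chain_boundary (sum f S) = (\<Sum>s\<in>S. chain_boundary (f s))"
  by (induction S rule: infinite_finite_induct) (simp_all add: chain_boundary_add chain_boundary_0)

lemma chain_boundary_degree: "divisor_degree (chain_boundary x) = 0"
  unfolding divisor_degree_eq_0_iff chain_boundary_def
  using subset_UNIV[of "Poly_Mapping.keys x"]
  by (induction x rule: frag_induction) (auto simp: frag_extend_diff)

locale farey_presentation = extended_farey_symbol +
  fixes E :: "arc set"
  assumes reps: "representatives V star E"
begin

abbreviation ell :: "arc set" where "ell \<equiv> elliptic_arcs V star"
abbreviation A :: "arc set" where "A \<equiv> E \<union> ell"
abbreviation G where "G \<equiv> farey_group V star mu"
abbreviation R where "R \<equiv> group_ring G"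
abbreviation F where "F \<equiv> free_module R A"
abbreviation J where "J \<equiv> free_chain A"
abbreviation \<Phi> where "\<Phi> f \<equiv> chain_boundary (J f)"

lemma A_subset: "A \<subseteq> V"
  using reps by (auto simp: representatives_def elliptic_arcs_def)

lemma finite_A: "finite A" "finite E" "finite ell" "E \<inter> ell = {}"
  using A_subset finite_V finite_subset[of A V] reps by (auto simp: representatives_def)

lemma G_simps: "carrier G = \<Gamma>" "x \<otimes>\<^bsub>G\<^esub> y = x \<otimes>\<^bsub>PSL2Z\<^esub> y" "\<one>\<^bsub>G\<^esub> = \<one>\<^bsub>PSL2Z\<^esub>"
  by (simp_all add: farey_group_def)

lemma G_inv: "g \<in> \<Gamma> \<Longrightarrow> inv\<^bsub>G\<^esub> g = inv\<^bsub>PSL2Z\<^esub> g"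
  unfolding farey_group_def by (rule group.m_inv_consistent[OF group_PSL2Z subgroup_\<Gamma>])

lemma G_pow: "g [^]\<^bsub>G\<^esub> (n::nat) = g [^]\<^bsub>PSL2Z\<^esub> n"
  unfolding farey_group_def
  by (rule monoid.nat_pow_consistent[OF group.is_monoid[OF group_PSL2Z], symmetric])

lemma R_carrier: "x \<in> carrier R \<longleftrightarrow> Poly_Mapping.keys x \<subseteq> \<Gamma>"
  by (simp add: group_ring_def G_simps)

lemma F_carrier: "f \<in> carrier F \<Longrightarrow> a \<in> A \<Longrightarrow> Poly_Mapping.keys (f a) \<subseteq> \<Gamma>"
  by (auto simp: free_module_def PiE_iff R_carrier[symmetric])

lemma F_module: "left_module R F"
  by (rule left_modules(2))

lemma Delta0_module: "left_module R Delta0"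
  by (rule left_modules(1))

lemma J_add: "J (f \<oplus>\<^bsub>F\<^esub> h) = J f + J h"
  by (simp add: free_chain_def free_module_def group_ring_def sum.distrib)

lemma J_zero: "J \<zero>\<^bsub>F\<^esub> = 0"
  by (simp add: free_chain_def free_module_def group_ring_def)

lemma J_smult: "J (x \<odot>\<^bsub>F\<^esub> f) = frag_extend (\<lambda>g. translate g (J f)) x"
proof -
  have "J (x \<odot>\<^bsub>F\<^esub> f) = (\<Sum>a\<in>A. frag_extend (\<lambda>g. translate g (symbols_at a (f a))) x)"
    unfolding free_chain_def
    by (rule sum.cong)
      (simp_all add: free_module_def group_ring_def G_simps translate_symbols_at, simp add: symbols_at_def frag_extend_frag_extend)
  then show ?thesis by (simp add: free_chain_def translate_sum frag_extend_fun_sum)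
qed

lemma J_keys: "f \<in> carrier F \<Longrightarrow> Poly_Mapping.keys (J f) \<subseteq> \<Gamma> \<times> A"
proof -
  assume f: "f \<in> carrier F"
  have "Poly_Mapping.keys (J f) \<subseteq> (\<Union>a\<in>A. Poly_Mapping.keys (symbols_at a (f a)))"
    unfolding free_chain_def by (rule keys_sum)
  also have "\<dots> \<subseteq> \<Gamma> \<times> A" using symbols_at_keys F_carrier[OF f] by fast
  finally show ?thesis .
qed

lemma J_chains: "f \<in> carrier F \<Longrightarrow> J f \<in> psl_chains"
  using J_keys \<Gamma>_carrier unfolding psl_chains_def by blast

lemma J_inj: "f \<in> carrier F \<Longrightarrow> h \<in> carrier F \<Longrightarrow> J f = J h \<Longrightarrow> f = h"
proof -
  assume f: "f \<in> carrier F" and h: "h \<in> carrier F" and eq: "J f = J h"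
  have "f a = h a" if "a \<in> A" for a
    using free_chain_component[OF finite_A(1) that, of f] free_chain_component[OF finite_A(1) that, of h] eq
    by simp
  moreover have "f \<in> A \<rightarrow>\<^sub>E carrier R" "h \<in> A \<rightarrow>\<^sub>E carrier R"
    using f h by (simp_all add: free_module_def)
  ultimately show ?thesis by (intro PiE_ext[of f A _ h]) blast+
qed

lemma frag_of_R: "g \<in> \<Gamma> \<Longrightarrow> frag_of g \<in> carrier R"
  by (simp add: R_carrier)

lemma free_gen_carrier: "free_gen R A a \<in> carrier F"
proof -
  have "\<one>\<^bsub>R\<^esub> \<in> carrier R" "\<zero>\<^bsub>R\<^esub> \<in> carrier R"
    using \<Gamma>_one by (auto simp: group_ring_def G_simps)
  then show ?thesis using finite_A by (auto simp: free_module_def free_gen_def)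
qed

lemma J_free_gen: "a \<in> A \<Longrightarrow> J (free_gen R A a) = frag_of (\<one>\<^bsub>PSL2Z\<^esub>, a)"
proof -
  assume a: "a \<in> A"
  have "J (free_gen R A a) = (\<Sum>b\<in>A. if b = a then frag_of (\<one>\<^bsub>PSL2Z\<^esub>, b) else 0)"
    unfolding free_chain_def by (rule sum.cong) (auto simp: free_gen_def group_ring_def G_simps)
  then show ?thesis using a finite_A by (simp add: sum.delta')
qed

lemma J_smult_free_gen: "x \<in> carrier R \<Longrightarrow> a \<in> A \<Longrightarrow> J (x \<odot>\<^bsub>F\<^esub> free_gen R A a) = symbols_at a x"
proof -
  interpret group PSL2Z by (rule group_PSL2Z)
  assume "x \<in> carrier R" "a \<in> A"
  then show ?thesis unfolding J_smult symbols_at_def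
    by (intro frag_extend_eq) (auto simp: J_free_gen R_carrier \<Gamma>_carrier subset_iff)
qed

lemma J_finsum:
  assumes "finite S" "\<And>s. s \<in> S \<Longrightarrow> f s \<in> carrier F"
  shows "J (\<Oplus>\<^bsub>F\<^esub> s\<in>S. f s) = (\<Sum>s\<in>S. J (f s))"
proof -
  interpret left_module R F by (rule F_module)
  show ?thesis using assms
  proof (induction S rule: finite_induct)
    case (insert s S)
    then have "(\<Oplus>\<^bsub>F\<^esub> s\<in>insert s S. f s) = f s \<oplus>\<^bsub>F\<^esub> (\<Oplus>\<^bsub>F\<^esub> s\<in>S. f s)"
      by (intro M.finsum_insert) auto
    then show ?case using insert by (simp add: J_add)
  qed (simp add: J_zero)
qed

lemma \<Phi>_smult:
  assumes "x \<in> carrier R" "f \<in> carrier F"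
  shows "\<Phi> (x \<odot>\<^bsub>F\<^esub> f) = x \<odot>\<^bsub>Delta0\<^esub> \<Phi> f"
proof -
  have "\<Phi> (x \<odot>\<^bsub>F\<^esub> f) = frag_extend (\<lambda>g. chain_boundary (translate g (J f))) x"
    unfolding J_smult chain_boundary_def by (rule frag_extend_frag_extend)
  also have "\<dots> = frag_extend (\<lambda>g. divisor_act g (\<Phi> f)) x"
    using assms J_chains[OF assms(2)]
    by (intro frag_extend_eq) (auto simp: R_carrier intro!: chain_boundary_translate \<Gamma>_carrier)
  finally show ?thesis by (simp add: Delta0_def divisor_act_def)
qed

lemma farey_mu_symbols:
  assumes "a \<in> ell"
  shows "farey_mu V star mu a \<in> carrier R"
    "J (farey_mu V star mu a \<odot>\<^bsub>F\<^esub> free_gen R A a) = (\<Sum>s<mu a. frag_of (glue a [^]\<^bsub>PSL2Z\<^esub> s, a))"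
proof -
  have a: "a \<in> V" "a \<in> A" using assms by (auto simp: elliptic_arcs_def)
  have pow: "glue a [^]\<^bsub>PSL2Z\<^esub> (s::nat) \<in> \<Gamma>" for s
    by (induction s) (simp_all add: \<Gamma>_one \<Gamma>_mult glue_\<Gamma>[OF a(1)])
  have "Poly_Mapping.keys (farey_mu V star mu a) \<subseteq> (\<Union>s\<in>{..<mu a}. Poly_Mapping.keys (frag_of (glue a [^]\<^bsub>PSL2Z\<^esub> s)))"
    unfolding farey_mu_def Let_def G_pow by (rule keys_sum)
  then show R: "farey_mu V star mu a \<in> carrier R" using pow by (auto simp: R_carrier)
  show "J (farey_mu V star mu a \<odot>\<^bsub>F\<^esub> free_gen R A a) = (\<Sum>s<mu a. frag_of (glue a [^]\<^bsub>PSL2Z\<^esub> s, a))"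
    unfolding J_smult_free_gen[OF R a(2)] by (simp add: farey_mu_def Let_def G_pow symbols_at_sum)
qed

lemma farey_lambda_R: "a \<in> A \<Longrightarrow> farey_lambda V star mu a \<in> carrier R"
proof -
  assume "a \<in> A"
  then have "a \<in> V" using A_subset by blast
  then have "glue a \<in> \<Gamma>" by (rule glue_\<Gamma>)
  then have "frag_of (\<one>\<^bsub>PSL2Z\<^esub>) \<in> carrier R" "frag_of (inv\<^bsub>PSL2Z\<^esub> (glue a)) \<in> carrier R"
    using \<Gamma>_one \<Gamma>_inv frag_of_R by auto
  then show ?thesis using keys_diff[of "frag_of \<one>\<^bsub>PSL2Z\<^esub>" "frag_of (inv\<^bsub>PSL2Z\<^esub> (glue a))"]
    \<open>glue a \<in> \<Gamma>\<close> unfolding R_carrier farey_lambda_def Let_def by (auto simp: G_simps G_inv)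
qed

lemma boundary_relation_symbols:
  "J (\<Oplus>\<^bsub>F\<^esub> a \<in> A. farey_lambda V star mu a \<odot>\<^bsub>F\<^esub> free_gen R A a) =
    (\<Sum>a\<in>E. frag_of (\<one>\<^bsub>PSL2Z\<^esub>, a) - frag_of (inv\<^bsub>PSL2Z\<^esub> (glue a), a)) + (\<Sum>a\<in>ell. frag_of (\<one>\<^bsub>PSL2Z\<^esub>, a))"
proof -
  interpret left_module R F by (rule F_module)
  have "J (\<Oplus>\<^bsub>F\<^esub> a \<in> A. farey_lambda V star mu a \<odot>\<^bsub>F\<^esub> free_gen R A a) =
      (\<Sum>a\<in>A. symbols_at a (farey_lambda V star mu a))"
    using finite_A farey_lambda_R free_gen_carrier
    by (subst J_finsum) (auto simp: J_smult_free_gen intro!: smult_closed)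
  also have "\<dots> = (\<Sum>a\<in>E. symbols_at a (farey_lambda V star mu a)) + (\<Sum>a\<in>ell. symbols_at a (farey_lambda V star mu a))"
    using finite_A by (intro sum.union_disjoint) auto
  also have "(\<Sum>a\<in>E. symbols_at a (farey_lambda V star mu a)) =
      (\<Sum>a\<in>E. frag_of (\<one>\<^bsub>PSL2Z\<^esub>, a) - frag_of (inv\<^bsub>PSL2Z\<^esub> (glue a), a))"
    using finite_A(4) A_subset
    by (intro sum.cong) (auto simp: farey_lambda_def Let_def G_simps G_inv glue_\<Gamma>)
  also have "(\<Sum>a\<in>ell. symbols_at a (farey_lambda V star mu a)) = (\<Sum>a\<in>ell. frag_of (\<one>\<^bsub>PSL2Z\<^esub>, a))"
    by (intro sum.cong) (auto simp: farey_lambda_def Let_def G_simps)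
  finally show ?thesis .
qed

lemma relations_carrier: "farey_relations V star mu A \<subseteq> carrier F"
proof -
  interpret left_module R F by (rule F_module)
  show ?thesis using farey_lambda_R free_gen_carrier farey_mu_symbols(1)
    by (auto simp: farey_relations_def Let_def intro!: smult_closed M.finsum_closed)
qed

abbreviation N where "N \<equiv> generated_submodule R F (farey_relations V star mu A)"

lemma N_submodule: "submodule N R F"
  by (rule submodule_generated_submodule[OF F_module relations_carrier])

lemma relations_N: "x \<in> farey_relations V star mu A \<Longrightarrow> x \<in> N"
  by (auto simp: generated_submodule_def)

lemma farey_chains_N: "farey_chains V star mu E (J ` N)"
proof -
  interpret F: left_module R F by (rule F_module)
  interpret N: submodule N R F by (rule N_submodule)
  have Nc: "f \<in> carrier F" if "f \<in> N" for f using that N.subset by auto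
  have J_minus: "J (\<ominus>\<^bsub>F\<^esub> f) = - J f" if "f \<in> carrier F" for f
    using J_add[of f "\<ominus>\<^bsub>F\<^esub> f"] F.r_neg[OF that] J_zero by (simp add: eq_neg_iff_add_eq_0 add.commute)
  have N_neg: "\<ominus>\<^bsub>F\<^esub> f \<in> N" if "f \<in> N" for f
    using N.m_inv_closed[OF that] by (simp add: a_inv_def)
  show ?thesis
  proof (unfold_locales)
    show "representatives V star E" by (rule reps)
    show "0 \<in> J ` N" using N.one_closed J_zero by (metis image_eqI monoid.select_convs(2))
    fix x y assume "x \<in> J ` N" "y \<in> J ` N"
    then obtain f h where fh: "f \<in> N" "h \<in> N" "x = J f" "y = J h" by auto
    have "x - y = J (f \<oplus>\<^bsub>F\<^esub> \<ominus>\<^bsub>F\<^esub> h)" using fh Nc by (simp add: J_add J_minus)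
    moreover have "f \<oplus>\<^bsub>F\<^esub> \<ominus>\<^bsub>F\<^esub> h \<in> N" using N.m_closed[of f "\<ominus>\<^bsub>F\<^esub> h"] fh N_neg by simp
    ultimately show "x - y \<in> J ` N" by blast
  next
    fix g x assume g: "g \<in> \<Gamma>" and "x \<in> J ` N"
    then obtain f where f: "f \<in> N" "x = J f" by auto
    have "translate g x = J (frag_of g \<odot>\<^bsub>F\<^esub> f)" by (simp add: J_smult f)
    then show "translate g x \<in> J ` N" using N.smult_closed[OF frag_of_R[OF g] f(1)] by blast
  next
    show "(\<Sum>a\<in>E. frag_of (\<one>\<^bsub>PSL2Z\<^esub>, a) - frag_of (inv\<^bsub>PSL2Z\<^esub> (glue a), a)) + (\<Sum>a\<in>ell. frag_of (\<one>\<^bsub>PSL2Z\<^esub>, a)) \<in> J ` N"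
      unfolding boundary_relation_symbols[symmetric]
      by (intro imageI relations_N) (simp add: farey_relations_def Let_def)
  next
    fix a assume a: "a \<in> ell"
    show "(\<Sum>s<mu a. frag_of (glue a [^]\<^bsub>PSL2Z\<^esub> s, a)) \<in> J ` N"
      unfolding farey_mu_symbols(2)[OF a, symmetric]
      by (intro imageI relations_N) (use a in \<open>simp add: farey_relations_def Let_def\<close>)
  qed
qed

lemma \<Phi>_free_gen: "a \<in> A \<Longrightarrow> \<Phi> (free_gen R A a) = arc_divisor a"
  by (simp add: J_free_gen chain_boundary_def arc_divisor_def psl_act_one)

text \<open>A gluing of order 2 exchanges the ends of \<open>a\<close>; one of order 3 carries
  \<open>a\<close> around the triangle formed with its apex. Either way the boundaries
  cancel.\<close>

lemma \<Phi>_elliptic: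
  assumes a: "a \<in> ell"
  shows "chain_boundary (\<Sum>s<mu a. frag_of (glue a [^]\<^bsub>PSL2Z\<^esub> s, a)) = 0"
proof -
  interpret group PSL2Z by (rule group_PSL2Z)
  have aV: "a \<in> V" "star a = a" using a by (auto simp: elliptic_arcs_def)
  have g: "glue a \<in> carrier PSL2Z" using glue_carrier[OF aV(1)] .
  show ?thesis
  proof (cases "order3 a")
    case True
    then have "mu a = 3" by (simp add: order3_def)
    then show ?thesis using glue_order3(1,2)[OF aV(1) True] g
      by (simp add: numeral_3_eq_3 chain_boundary_def frag_extend_add psl_act_mult psl_act_one)
  next
    case False
    then have "mu a = 2" using mu_range[OF a] aV by (auto simp: order3_def)
    then show ?thesis using glue_order2(1,2)[OF aV(1) False] aV(2) g
      by (simp add: numeral_2_eq_2 chain_boundary_def frag_extend_add psl_act_one)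
  qed
qed

text \<open>Through \<open>C.symb_boundary\<close> the relation becomes a sum over all sides, each
  with the boundary of the side itself, and the boundary of the polygon is closed.\<close>

lemma \<Phi>_boundary:
  "chain_boundary ((\<Sum>a\<in>E. frag_of (\<one>\<^bsub>PSL2Z\<^esub>, a) - frag_of (inv\<^bsub>PSL2Z\<^esub> (glue a), a)) + (\<Sum>a\<in>ell. frag_of (\<one>\<^bsub>PSL2Z\<^esub>, a))) = 0"
proof -
  interpret C: farey_chains V star mu E "J ` N" by (rule farey_chains_N)
  have "chain_boundary (C.symb \<one>\<^bsub>PSL2Z\<^esub> a) = frag_of (snd a) - frag_of (fst a)" if a: "a \<in> V" for a
  proof (cases "a \<in> A")
    case False
    then have "star a \<noteq> a" using a by (auto simp: elliptic_arcs_def)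
    then have "\<not> order3 a" by (simp add: order3_def)
    then show ?thesis
      using False glue_order2(1,2)[OF a] monoid.l_one[OF group.is_monoid[OF group_PSL2Z] glue_carrier[OF a]]
      by (simp add: C.symb_def chain_boundary_def frag_extend_minus)
  qed (simp add: C.symb_def chain_boundary_def psl_act_one)
  then have "chain_boundary (\<Sum>a\<in>V. C.symb \<one>\<^bsub>PSL2Z\<^esub> a) = (\<Sum>a\<in>V. frag_of (snd a) - frag_of (fst a))"
    by (simp add: chain_boundary_sum)
  also have "\<dots> = 0" using sum_fst_snd[of frag_of] by (simp add: sum_subtractf)
  finally show ?thesis by (simp add: C.symb_boundary)
qed

lemma \<Phi>_add: "\<Phi> (f \<oplus>\<^bsub>F\<^esub> h) = \<Phi> f + \<Phi> h"
  by (simp add: J_add chain_boundary_add)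

lemma \<Phi>_kernel:
  assumes f: "f \<in> carrier F"
  shows "\<Phi> f = 0 \<longleftrightarrow> f \<in> N"
proof
  assume "\<Phi> f = 0"
  then have "J f \<in> J ` N"
    using farey_chains.boundary_zero_imp_relation[OF farey_chains_N J_keys[OF f]] by simp
  then obtain h where h: "h \<in> N" "J f = J h" by auto
  moreover have "h \<in> carrier F" using h(1) N_submodule
    by (auto simp: submodule_def dest!: subgroup.subset)
  ultimately show "f \<in> N" using J_inj[OF f] by blast
next
  interpret F: left_module R F by (rule F_module)
  interpret D: left_module R Delta0 by (rule Delta0_module)
  \<comment> \<open>Conversely, the kernel is a submodule containing the relations, and therefore
    contains the submodule they generate.\<close>
  let ?K = "{f \<in> carrier F. \<Phi> f = 0}"
  have "subgroup ?K (add_monoid F)"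
  proof (rule group.subgroupI[OF F.M.a_group])
    have "\<zero>\<^bsub>F\<^esub> \<in> ?K" using F.zero_closed by (simp add: J_zero chain_boundary_0)
    then show "?K \<noteq> {}" by blast
  next
    fix f assume "f \<in> ?K"
    then show "inv\<^bsub>add_monoid F\<^esub> f \<in> ?K"
      using \<Phi>_add[of f "\<ominus>\<^bsub>F\<^esub> f"] J_zero
      by (auto simp: F.r_neg chain_boundary_0 simp flip: a_inv_def)
  qed (auto simp: \<Phi>_add)
  moreover have "x \<odot>\<^bsub>F\<^esub> f \<in> ?K" if "x \<in> carrier R" "f \<in> ?K" for x f
    using that by (simp add: \<Phi>_smult F.smult_closed) (simp add: Delta0_def frag_extend_eq_0)
  ultimately have "submodule ?K R F"
    by (intro submodule.intro submodule_axioms.intro) auto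
  moreover have "farey_relations V star mu A \<subseteq> ?K"
    using relations_carrier \<Phi>_elliptic \<Phi>_boundary
    unfolding farey_relations_def Let_def by (auto simp: boundary_relation_symbols farey_mu_symbols)
  ultimately have "N \<subseteq> ?K" by (auto simp: generated_submodule_def)
  then show "f \<in> N \<Longrightarrow> \<Phi> f = 0" by auto
qed

lemma \<Phi>_image: "\<Phi> ` carrier F = carrier Delta0"
proof
  show "\<Phi> ` carrier F \<subseteq> carrier Delta0" by (auto simp: Delta0_def chain_boundary_degree)
  interpret F: left_module R F by (rule F_module)
  let ?I = "\<Phi> ` carrier F"
  have minus: "\<Phi> (\<ominus>\<^bsub>F\<^esub> f) = - \<Phi> f" if "f \<in> carrier F" for f
    using \<Phi>_add[of f "\<ominus>\<^bsub>F\<^esub> f"] F.r_neg[OF that] J_zero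
    by (simp add: chain_boundary_0 eq_neg_iff_add_eq_0 add.commute)
  have act: "divisor_act g x \<in> ?I" if g: "g \<in> \<Gamma>" and x: "x \<in> ?I" for g x
  proof -
    obtain f where f: "f \<in> carrier F" "x = \<Phi> f" using x by blast
    have "divisor_act g x = \<Phi> (frag_of g \<odot>\<^bsub>F\<^esub> f)"
      using \<Phi>_smult[OF frag_of_R[OF g] f(1)] f(2) by (simp add: Delta0_def divisor_act_def)
    then show ?thesis using F.smult_closed[OF frag_of_R[OF g] f(1)] by blast
  qed
  have diff: "x - y \<in> ?I" if xy: "x \<in> ?I" "y \<in> ?I" for x y
  proof -
    obtain f h where fh: "f \<in> carrier F" "h \<in> carrier F" "x = \<Phi> f" "y = \<Phi> h" using xy by blast
    then have "x - y = \<Phi> (f \<oplus>\<^bsub>F\<^esub> \<ominus>\<^bsub>F\<^esub> h)" by (simp add: \<Phi>_add minus)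
    then show ?thesis using fh F.a_closed F.a_inv_closed by blast
  qed
  have "0 = \<Phi> \<zero>\<^bsub>F\<^esub>" by (simp add: J_zero chain_boundary_0)
  then have zero: "0 \<in> ?I" using F.zero_closed by (rule image_eqI)
  have gen: "arc_divisor a \<in> ?I" if "a \<in> A" for a
    using \<Phi>_free_gen[OF that, symmetric] free_gen_carrier by (rule image_eqI)
  have sides: "arc_divisor a \<in> ?I" if a: "a \<in> V" for a
  proof (cases "a \<in> A")
    case False
    then have "star a \<noteq> a" using a by (auto simp: elliptic_arcs_def)
    then have "\<not> order3 a" by (simp add: order3_def)
    from glue_order2(1,2)[OF a this]
    \<comment> \<open>The gluing carries the partner of \<open>a\<close> onto \<open>a\<close> with
      reversed orientation.\<close>
    have "arc_divisor a = 0 - divisor_act (glue a) (arc_divisor (star a))"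
      by (simp add: arc_divisor_def divisor_act_def frag_extend_diff)
    moreover have "star a \<in> A" using False a reps by (auto simp: representatives_def)
    ultimately show ?thesis using diff[OF zero act[OF glue_\<Gamma>[OF a] gen]] by simp
  qed (rule gen)
  show "carrier Delta0 \<subseteq> ?I"
  proof
    fix D assume "D \<in> carrier Delta0"
    then have "divisor_degree D = 0" by (simp add: Delta0_def)
    show "D \<in> ?I"
      by (rule degree_zero_generated[where I = ?I]) (fact zero diff act sides | fact)+
  qed
qed

lemma presentation:
  "\<exists>\<phi> \<in> left_module_iso R (quotient_module F N) Delta0. \<forall>a \<in> A. \<phi> (N +>\<^bsub>F\<^esub> free_gen R A a) = arc_divisor a"
proof -
  have "abelian_group Delta0" using Delta0_module by (simp add: left_module_def)
  then have "\<exists>\<phi> \<in> left_module_iso R (quotient_module F N) Delta0. \<forall>x\<in>carrier F. \<phi> (N +>\<^bsub>F\<^esub> x) = \<Phi> x"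
  proof (rule left_module_first_iso[OF F_module _ N_submodule])
    show "\<Phi> f = \<zero>\<^bsub>Delta0\<^esub> \<longleftrightarrow> f \<in> N" if "f \<in> carrier F" for f
      using \<Phi>_kernel[OF that] by (simp add: Delta0_def)
    show "\<Phi> (f \<oplus>\<^bsub>F\<^esub> h) = \<Phi> f \<oplus>\<^bsub>Delta0\<^esub> \<Phi> h" for f h
      by (simp add: \<Phi>_add) (simp add: Delta0_def)
  qed (rule \<Phi>_smult \<Phi>_image; assumption?)+
  then obtain \<phi> where \<phi>: "\<phi> \<in> left_module_iso R (quotient_module F N) Delta0"
    "\<And>x. x \<in> carrier F \<Longrightarrow> \<phi> (N +>\<^bsub>F\<^esub> x) = \<Phi> x" by blast
  have "\<phi> (N +>\<^bsub>F\<^esub> free_gen R A a) = arc_divisor a" if "a \<in> A" for a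
    using \<phi>(2)[OF free_gen_carrier] \<Phi>_free_gen[OF that] by (rule trans)
  then show ?thesis using \<phi>(1) by blast
qed

end

theorem mainTheorem4:
  fixes V E \<A> :: "arc set" and star :: "arc \<Rightarrow> arc" and mu :: "arc \<Rightarrow> nat"
  assumes "extended_farey_symbol V star mu"
    and "representatives V star E"
    and "(Infty, Fin 0) \<in> E"
    and "\<A> = E \<union> elliptic_arcs V star"
  defines "R \<equiv> group_ring (farey_group V star mu)"
  defines "F \<equiv> free_module R \<A>"
  defines "N \<equiv> generated_submodule R F (farey_relations V star mu \<A>)"
  shows "\<exists>\<phi> \<in> left_module_iso R (quotient_module F N) Delta0.
           \<forall>a \<in> \<A>. \<phi> (N +>\<^bsub>F\<^esub> free_gen R \<A> a) = arc_divisor a"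
proof -
  have "farey_presentation V star mu E"
    using assms(1,2) by (simp add: farey_presentation_def farey_presentation_axioms_def)
  from farey_presentation.presentation[OF this] show ?thesis
    unfolding R_def F_def N_def assms(4) .
qed

end
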